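(* For every $0$-free monoid $M$ (with $1\neq 0$) one has $\mathrm{c.d.}\,M\le 1$.
   Context: Category of factorizations. Let $S$ be a monoid with zero element $0$. The category $\mathcal{F}ac\,S$ has as objects all nonzero elements of $S$; the set of morphisms $\mathrm{Mor}(a,b)$ consists of all triples $(\alpha,a,\beta)$ with $\alpha,\beta\in S$ such that $\alpha a\beta=b$. The triple is abbreviated $(\alpha,\beta)$ when no confusion arises. Composition is $(\alpha',\beta')(\alpha,\beta)=(\alpha'\alpha,\beta\beta')$. Natural systems. A natural system on $S$ is a functor $\mathbf{D}:\mathcal{F}ac\,S\to \mathcal{A}b$ to the category of abelian groups. $\mathcal{N}at\,S=\mathcal{A}b^{\mathcal{F}ac\,S}$ is the category of natural systems on $S$ with natural transformations as morphisms. Write $\mathbf{D}_a$ for the value of $\mathbf{D}$ at the object $a$, and $\alpha_*$, $\beta^*$ for the values of $\mathbf{D}$ at morphisms $(\alpha,1)$ and $(1,\beta)$ respectively; thus $\mathbf{D}(\alpha,\beta)=\alpha_*\beta^*$. Cohomology. For $n\ge 1$, let $Ner_n S$ be the set of all $n$-tuples $(a_1,\ldots,a_n)$ of elements of $S$ with $a_1\cdots a_n\neq 0$. For $n\ge1$, an $n$-cochain with values in $\mathbf{D}$ is a function $f$ assigning to each $(a_1,\ldots,a_n)\in Ner_n S$ an element $f(a_1,\ldots,a_n)\in\mathbf{D}_{a_1\cdots a_n}$; $C^n(S,\mathbf{D})$ is the abelian group of $n$-cochains under pointwise addition. Set $C^0(S,\mathbf{D})=\mathbf{D}_1$. The coboundary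 $\delta^n:C^n(S,\mathbf{D})\to C^{n+1}(S,\mathbf{D})$ is given for $n\ge 1$ by $$(\delta^n f)(a_1,\ldots,a_{n+1})=(a_1)_*f(a_2,\ldots,a_{n+1})+\sum_{i=1}^{n}(-1)^i f(a_1,\ldots,a_ia_{i+1},\ldots,a_{n+1})+(-1)^{n+1}(a_{n+1})^*f(a_1,\ldots,a_n),$$ and for $n=0$ by $(\delta^0 f)(x)=x_*f-x^*f$ for $f\in \mathbf{D}_1$, $x\in S\setminus\{0\}$. $H^n(S,\mathbf{D})$ denotes the $n$-th cohomology group of the complex $\{C^n(S,\mathbf{D}),\delta^n\}_{n\ge0}$. Cohomological dimension. The cohomological dimension $\mathrm{c.d.}\,S$ of a monoid $S$ with zero is the greatest natural number $n$ such that $H^n(S,\mathbf{D})\neq 0$ for some $\mathbf{D}\in\mathcal{N}at\,S$. Thus $\mathrm{c.d.}\,S\le 1$ means that $H^n(S,\mathbf{D})=0$ for all $n\ge 2$ and all natural systems $\mathbf{D}$ on $S$. $0$-free monoids. A monoid is called $0$-free if it is isomorphic to a Rees factor monoid $W/I$ of a free monoid $W$ by a two-sided ideal $I$ of $W$ (the monoid obtained by collapsing $I$ to a single zero element). A free monoid with an adjoined zero element is also regarded as a $0$-free monoid. The free monoid may be on an arbitrary set of generators. *)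

theory Defs
  imports "HOL-Algebra.FiniteProduct" "HOL-Algebra.Product_Groups" "HOL-Library.Extended_Nat"
begin

section \<open>Monoids with zero and 0-free monoids\<close>

locale monoid_with_zero = monoid S for S :: "('a, 'm) monoid_scheme" (structure) +
  fixes z :: 'a
  assumes zero_closed: "z \<in> carrier S"
    and zero_left: "x \<in> carrier S \<Longrightarrow> z \<otimes> x = z"
    and zero_right: "x \<in> carrier S \<Longrightarrow> x \<otimes> z = z"

definition free_monoid :: "'x set \<Rightarrow> 'x list monoid" where
  "free_monoid X = \<lparr>carrier = lists X, monoid.mult = (@), one = []\<rparr>"

definition two_sided_ideal :: "('a, 'm) monoid_scheme \<Rightarrow> 'a set \<Rightarrow> bool" where
  "two_sided_ideal S I \<longleftrightarrow> I \<subseteq> carrier S \<and> I \<noteq> {} \<and>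
     (\<forall>s\<in>carrier S. \<forall>x\<in>I. s \<otimes>\<^bsub>S\<^esub> x \<in> I \<and> x \<otimes>\<^bsub>S\<^esub> s \<in> I)"

text \<open>The class of the elements of \<open>I\<close> is \<^term>\<open>None\<close>; the class of an element \<open>x\<close> outside
  \<open>I\<close>, which is a singleton, is \<^term>\<open>Some x\<close>.\<close>

definition rees_class :: "'a set \<Rightarrow> 'a \<Rightarrow> 'a option" where
  "rees_class I x = (if x \<in> I then None else Some x)"

definition rees_factor :: "('a, 'm) monoid_scheme \<Rightarrow> 'a set \<Rightarrow> 'a option monoid" where
  "rees_factor S I =
     \<lparr>carrier = rees_class I ` carrier S,
      monoid.mult = (\<lambda>u v. case (u, v) of
         (Some x, Some y) \<Rightarrow> rees_class I (x \<otimes>\<^bsub>S\<^esub> y) | _ \<Rightarrow> None),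
      one = rees_class I \<one>\<^bsub>S\<^esub>\<rparr>"

definition adjoin_zero :: "('a, 'm) monoid_scheme \<Rightarrow> 'a option monoid" where
  "adjoin_zero S =
     \<lparr>carrier = insert None (Some ` carrier S),
      monoid.mult = (\<lambda>u v. case (u, v) of (Some x, Some y) \<Rightarrow> Some (x \<otimes>\<^bsub>S\<^esub> y) | _ \<Rightarrow> None),
      one = Some \<one>\<^bsub>S\<^esub>\<rparr>"

text \<open>The set of free generators is an argument, of an arbitrary type: a monoid is 0-free if it
  is 0-free on some set \<open>X\<close>.\<close>

definition zero_free_on :: "'x set \<Rightarrow> ('a, 'm) monoid_scheme \<Rightarrow> bool" where
  "zero_free_on X M \<longleftrightarrow>
     (\<exists>I. two_sided_ideal (free_monoid X) I \<and> M \<cong> rees_factor (free_monoid X) I) \<or>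
     M \<cong> adjoin_zero (free_monoid X)"

lemma monoid_free_monoid: "monoid (free_monoid X)"
  by unfold_locales (auto simp: free_monoid_def)

lemma monoid_with_zero_rees_factor:
  assumes "monoid S" and I: "two_sided_ideal S I"
  shows "monoid_with_zero (rees_factor S I) None"
proof -
  interpret monoid S by fact
  have Il: "s \<otimes>\<^bsub>S\<^esub> x \<in> I" and Ir: "x \<otimes>\<^bsub>S\<^esub> s \<in> I" if "s \<in> carrier S" "x \<in> I" for s x
    using I that by (auto simp: two_sided_ideal_def)
  have carr: "carrier (rees_factor S I) = insert None (Some ` (carrier S - I))"
    using I by (force simp: rees_factor_def rees_class_def two_sided_ideal_def)
  have mult: "rees_class I x \<otimes>\<^bsub>rees_factor S I\<^esub> rees_class I y = rees_class I (x \<otimes>\<^bsub>S\<^esub> y)"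
    if "x \<in> carrier S" "y \<in> carrier S" for x y
    using that Il Ir by (auto simp: rees_factor_def rees_class_def)
  have img: "carrier (rees_factor S I) = rees_class I ` carrier S"
    "\<one>\<^bsub>rees_factor S I\<^esub> = rees_class I \<one>\<^bsub>S\<^esub>"
    by (auto simp: rees_factor_def)
  show ?thesis
  proof unfold_locales
    show "None \<in> carrier (rees_factor S I)"
      by (simp add: carr)
    show "None \<otimes>\<^bsub>rees_factor S I\<^esub> u = None" "u \<otimes>\<^bsub>rees_factor S I\<^esub> None = None" for u
      by (auto simp: rees_factor_def split: option.split)
  qed (auto simp: img mult m_assoc)
qed

lemma monoid_with_zero_adjoin_zero:
  assumes "monoid S"
  shows "monoid_with_zero (adjoin_zero S) None"
proof -
  interpret monoid S by fact
  show ?thesis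
    by unfold_locales (auto simp: adjoin_zero_def m_assoc)
qed


section \<open>The category of factorizations and natural systems\<close>

definition fac_obj :: "('a, 'm) monoid_scheme \<Rightarrow> 'a \<Rightarrow> 'a set" where
  "fac_obj S z = carrier S - {z}"

definition fac_mor :: "('a, 'm) monoid_scheme \<Rightarrow> 'a \<Rightarrow> 'a \<Rightarrow> ('a \<times> 'a \<times> 'a) set" where
  "fac_mor S a b =
     {(\<alpha>, a, \<beta>) |\<alpha> \<beta>. \<alpha> \<in> carrier S \<and> \<beta> \<in> carrier S \<and> \<alpha> \<otimes>\<^bsub>S\<^esub> a \<otimes>\<^bsub>S\<^esub> \<beta> = b}"

fun fac_comp :: "('a, 'm) monoid_scheme \<Rightarrow> 'a \<times> 'a \<times> 'a \<Rightarrow> 'a \<times> 'a \<times> 'a \<Rightarrow> 'a \<times> 'a \<times> 'a" where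
  "fac_comp S (\<alpha>', _, \<beta>') (\<alpha>, a, \<beta>) = (\<alpha>' \<otimes>\<^bsub>S\<^esub> \<alpha>, a, \<beta> \<otimes>\<^bsub>S\<^esub> \<beta>')"

text \<open>A functor from the category of factorizations to abelian groups, with object part \<open>D\<close> and
  morphism part \<open>T\<close>. Abelian groups are written multiplicatively, and all the groups \<open>D a\<close> have
  carriers in one type \<open>'b\<close>; this is no restriction, since a family of groups can be
  embedded in the disjoint union of its members.\<close>

locale natural_system = monoid_with_zero S z for S :: "('a, 'm) monoid_scheme" (structure) and z +
  fixes D :: "'a \<Rightarrow> ('b, 'n) monoid_scheme"
    and T :: "'a \<times> 'a \<times> 'a \<Rightarrow> 'b \<Rightarrow> 'b"
  assumes comm_group_D: "a \<in> fac_obj S z \<Longrightarrow> comm_group (D a)"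
    and T_hom: "\<lbrakk>a \<in> fac_obj S z; b \<in> fac_obj S z; \<phi> \<in> fac_mor S a b\<rbrakk>
      \<Longrightarrow> T \<phi> \<in> hom (D a) (D b)"
    and T_id: "\<lbrakk>a \<in> fac_obj S z; x \<in> carrier (D a)\<rbrakk> \<Longrightarrow> T (\<one>, a, \<one>) x = x"
    and T_comp: "\<lbrakk>a \<in> fac_obj S z; b \<in> fac_obj S z; c \<in> fac_obj S z;
        \<phi> \<in> fac_mor S a b; \<psi> \<in> fac_mor S b c; x \<in> carrier (D a)\<rbrakk>
      \<Longrightarrow> T (fac_comp S \<psi> \<phi>) x = T \<psi> (T \<phi> x)"


section \<open>Cohomology\<close>

definition mprod :: "('a, 'm) monoid_scheme \<Rightarrow> 'a list \<Rightarrow> 'a" where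
  "mprod S as = foldr (\<otimes>\<^bsub>S\<^esub>) as \<one>\<^bsub>S\<^esub>"

definition Ner :: "('a, 'm) monoid_scheme \<Rightarrow> 'a \<Rightarrow> nat \<Rightarrow> 'a list set" where
  "Ner S z n = {as. length as = n \<and> set as \<subseteq> carrier S \<and> mprod S as \<noteq> z}"

text \<open>For \<open>n = 0\<close> and \<open>\<one> \<noteq> z\<close> the only element of \<^term>\<open>Ner S z 0\<close> is the empty tuple, with
  product \<open>\<one>\<close>; so \<^term>\<open>cochain_group S z D 0\<close> is \<^term>\<open>D \<one>\<^bsub>S\<^esub>\<close>, seen as a group of functions on a
  one-element set.\<close>

definition cochain_group ::
  "('a, 'm) monoid_scheme \<Rightarrow> 'a \<Rightarrow> ('a \<Rightarrow> ('b, 'n) monoid_scheme) \<Rightarrow> nat \<Rightarrow> ('a list \<Rightarrow> 'b) monoid" where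
  "cochain_group S z D n = product_group (Ner S z n) (\<lambda>as. D (mprod S as))"

text \<open>The tuple \<open>(a\<^sub>1, \<dots>, a\<^sub>i a\<^sub>i\<^sub>+\<^sub>1, \<dots>, a\<^sub>n\<^sub>+\<^sub>1)\<close>, for \<open>1 \<le> i \<le> n\<close>. The positions in a list start at 0.\<close>

definition merge_at :: "('a, 'm) monoid_scheme \<Rightarrow> nat \<Rightarrow> 'a list \<Rightarrow> 'a list" where
  "merge_at S i as = take (i - 1) as @ [as ! (i - 1) \<otimes>\<^bsub>S\<^esub> as ! i] @ drop (i + 1) as"

text \<open>The sign \<open>(-1)\<^sup>i\<close> becomes an exponent in the multiplicative notation. For \<open>n = 0\<close> the formula
  reads \<open>x\<^sub>* f - x\<^sup>* f\<close>; see \<open>coboundary_0\<close> below.\<close>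

definition coboundary ::
  "('a, 'm) monoid_scheme \<Rightarrow> 'a \<Rightarrow> ('a \<Rightarrow> ('b, 'n) monoid_scheme) \<Rightarrow> ('a \<times> 'a \<times> 'a \<Rightarrow> 'b \<Rightarrow> 'b)
    \<Rightarrow> nat \<Rightarrow> ('a list \<Rightarrow> 'b) \<Rightarrow> ('a list \<Rightarrow> 'b)" where
  "coboundary S z D T n f = (\<lambda>as \<in> Ner S z (Suc n).
     let G = D (mprod S as) in
       T (hd as, mprod S (tl as), \<one>\<^bsub>S\<^esub>) (f (tl as)) \<otimes>\<^bsub>G\<^esub>
       (\<Otimes>\<^bsub>G\<^esub>i\<in>{1..n}. f (merge_at S i as) [^]\<^bsub>G\<^esub> ((- 1) ^ i :: int)) \<otimes>\<^bsub>G\<^esub>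
       (T (\<one>\<^bsub>S\<^esub>, mprod S (butlast as), last as) (f (butlast as)) [^]\<^bsub>G\<^esub> ((- 1) ^ (n + 1) :: int)))"

definition cocycles ::
  "('a, 'm) monoid_scheme \<Rightarrow> 'a \<Rightarrow> ('a \<Rightarrow> ('b, 'n) monoid_scheme) \<Rightarrow> ('a \<times> 'a \<times> 'a \<Rightarrow> 'b \<Rightarrow> 'b)
    \<Rightarrow> nat \<Rightarrow> ('a list \<Rightarrow> 'b) set" where
  "cocycles S z D T n =
     kernel (cochain_group S z D n) (cochain_group S z D (Suc n)) (coboundary S z D T n)"

definition coboundaries ::
  "('a, 'm) monoid_scheme \<Rightarrow> 'a \<Rightarrow> ('a \<Rightarrow> ('b, 'n) monoid_scheme) \<Rightarrow> ('a \<times> 'a \<times> 'a \<Rightarrow> 'b \<Rightarrow> 'b)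
    \<Rightarrow> nat \<Rightarrow> ('a list \<Rightarrow> 'b) set" where
  "coboundaries S z D T n = (case n of
     0 \<Rightarrow> {\<one>\<^bsub>cochain_group S z D 0\<^esub>}
   | Suc m \<Rightarrow> coboundary S z D T m ` carrier (cochain_group S z D m))"

definition cohomology_group ::
  "('a, 'm) monoid_scheme \<Rightarrow> 'a \<Rightarrow> ('a \<Rightarrow> ('b, 'n) monoid_scheme) \<Rightarrow> ('a \<times> 'a \<times> 'a \<Rightarrow> 'b \<Rightarrow> 'b)
    \<Rightarrow> nat \<Rightarrow> ('a list \<Rightarrow> 'b) set monoid" where
  "cohomology_group S z D T n =
     (cochain_group S z D n)\<lparr>carrier := cocycles S z D T n\<rparr> Mod coboundaries S z D T n"

text \<open>The type argument says where the groups of the natural systems live. A theorem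
  \<open>cohomological_dimension TYPE('b) S z \<le> n\<close> with a free type variable \<open>'b\<close> is about all natural
  systems on \<open>S\<close>. The value is infinite if there is no greatest \<open>n\<close> with nonzero cohomology.\<close>

definition cohomological_dimension ::
  "'b itself \<Rightarrow> ('a, 'm) monoid_scheme \<Rightarrow> 'a \<Rightarrow> enat" where
  "cohomological_dimension (U :: 'b itself) S z = Sup {enat n |n.
     \<exists>(D :: 'a \<Rightarrow> 'b monoid) T. natural_system S z D T \<and>
       \<not> trivial_group (cohomology_group S z D T n)}"

lemma cohomological_dimension_le_iff:
  "cohomological_dimension TYPE('b) S z \<le> enat k \<longleftrightarrow>
    (\<forall>n>k. \<forall>(D :: 'a \<Rightarrow> 'b monoid) T. natural_system S z D T \<longrightarrow>
       trivial_group (cohomology_group S z D T n))"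
proof -
  have eq: "Sup {enat n |n. P n} \<le> enat k \<longleftrightarrow> (\<forall>n>k. \<not> P n)" for P
    by (auto simp: Sup_le_iff not_le[symmetric] simp del: not_le)
  show ?thesis
    unfolding cohomological_dimension_def eq by blast
qed

lemma (in natural_system) coboundary_0:
  assumes x: "x \<in> fac_obj S z" and one: "\<one> \<noteq> z" and f: "f \<in> carrier (cochain_group S z D 0)"
  shows "coboundary S z D T 0 f [x] =
    T (x, \<one>, \<one>) (f []) \<otimes>\<^bsub>D x\<^esub> inv\<^bsub>D x\<^esub> T (\<one>, \<one>, x) (f [])"
proof -
  have xS: "x \<in> carrier S" "x \<noteq> z"
    using x by (auto simp: fac_obj_def)
  have obj: "\<one> \<in> fac_obj S z"
    using one by (simp add: fac_obj_def)
  interpret G: comm_group "D x" by (rule comm_group_D[OF x])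
  have f1: "f [] \<in> carrier (D \<one>)"
    using f one by (auto simp: cochain_group_def Ner_def mprod_def PiE_iff)
  have "T (x, \<one>, \<one>) \<in> hom (D \<one>) (D x)" "T (\<one>, \<one>, x) \<in> hom (D \<one>) (D x)"
    using xS by (auto intro!: T_hom[OF obj x] simp: fac_mor_def)
  then have "T (x, \<one>, \<one>) (f []) \<in> carrier (D x)" "T (\<one>, \<one>, x) (f []) \<in> carrier (D x)"
    using f1 by (auto simp: hom_def)
  then show ?thesis
    using xS by (simp add: coboundary_def Ner_def mprod_def Let_def G.int_pow_neg G.int_pow_1)
qed

end

theory Submission
  imports Defs
begin

text \<open>Additively, let \<open>f\<close> be an \<open>n\<close>-cocycle with \<open>n \<ge> 2\<close>. Subtracting the coboundary of
  \<open>(a, b, \<dots>) \<mapsto> a\<^sub>* f (1, 1, b, \<dots>)\<close> one may assume that \<open>f (1, b, \<dots>) = 0\<close>. In a 0-free monoid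
  every nonzero \<open>a \<noteq> 1\<close> is uniquely \<open>x w\<close> with a letter \<open>x\<close>, and \<open>a c = x (w c)\<close> is the
  splitting of every nonzero \<open>a c\<close>. So \<open>g (1, b, \<dots>) = 0\<close> and
  \<open>g (x w, b, \<dots>) = x\<^sub>* g (w, b, \<dots>) - f (x, w, b, \<dots>)\<close> define an \<open>(n - 1)\<close>-cochain, and
  the cocycle condition at \<open>(x, w, \<dots>)\<close> gives \<open>\<delta> g = f\<close> by induction on the length of the first entry.\<close>

section \<open>Alternating products\<close>

text \<open>The normalization is forced by the start of the induction: as \<open>g\<close> vanishes
  at tuples beginning with 1, so does its coboundary there, because the first two faces cancel and
  every other face again begins with 1. Hence \<open>f\<close> has to vanish there too. The
  correction works because the cocycle condition at (1, 1, b, ...) expresses f (1, b, ...) by values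
  at tuples beginning with 1, 1, and these are the faces of the subtracted cochain. For the
  induction step the recursion for \<open>g\<close> is compared with the cocycle condition face by
  face. Every face of (a, b, ...) other than the first merely multiplies \<open>a\<close> on the
  right by some c, and unique splitting says that a c splits with the same letter. Degree at least 2
  is needed for \<open>g\<close> to have a first entry at all. The values at different tuples lie in
  different groups, linked only by the functor, and the two outer faces are transported while the
  inner ones are not. Adding outer entries to the tuples removes this distinction.\<close>

definition altprod :: "('a, 'm) monoid_scheme \<Rightarrow> (nat \<Rightarrow> 'a) \<Rightarrow> nat \<Rightarrow> 'a" where
  "altprod G h n = (\<Otimes>\<^bsub>G\<^esub>i\<in>{..n}. h i [^]\<^bsub>G\<^esub> ((- 1) ^ i :: int))"

context comm_group
begin

lemma altprod_closed [simp]: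
  "(\<And>i. i \<le> n \<Longrightarrow> h i \<in> carrier G) \<Longrightarrow> altprod G h n \<in> carrier G"
  by (auto simp: altprod_def intro!: finprod_closed)

lemma altprod_cong:
  "\<lbrakk>\<And>i. i \<le> n \<Longrightarrow> h i = k i; \<And>i. i \<le> n \<Longrightarrow> k i \<in> carrier G\<rbrakk> \<Longrightarrow> altprod G h n = altprod G k n"
  unfolding altprod_def by (rule finprod_cong') auto

lemma altprod_0 [simp]: "h 0 \<in> carrier G \<Longrightarrow> altprod G h 0 = h 0"
  by (simp add: altprod_def int_pow_1)

lemma altprod_mult:
  assumes "\<And>i. i \<le> n \<Longrightarrow> h i \<in> carrier G" "\<And>i. i \<le> n \<Longrightarrow> k i \<in> carrier G"
  shows "altprod G (\<lambda>i. h i \<otimes> k i) n = altprod G h n \<otimes> altprod G k n"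
proof -
  have "altprod G (\<lambda>i. h i \<otimes> k i) n =
      (\<Otimes>i\<in>{..n}. h i [^] ((- 1) ^ i :: int) \<otimes> k i [^] ((- 1) ^ i :: int))"
    unfolding altprod_def using assms by (intro finprod_cong') (auto simp: int_pow_distrib)
  then show ?thesis
    unfolding altprod_def using assms by (simp add: Pi_def)
qed

lemma altprod_one [simp]: "altprod G (\<lambda>i. \<one>) n = \<one>"
  by (simp add: altprod_def)

text \<open>The factors after the first and those of the shifted family have opposite exponents and
  cancel in pairs, which gives the inverse. This is the recursion, free of exponents, behind
  \<open>altprod_hom\<close> and \<open>altprod_altprod\<close>.\<close>

lemma altprod_Suc:
  assumes "\<And>i. i \<le> Suc n \<Longrightarrow> h i \<in> carrier G"
  shows "altprod G h (Suc n) = h 0 \<otimes> inv altprod G (\<lambda>i. h (Suc i)) n"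
proof -
  let ?s = "\<lambda>i. h (Suc i) [^] ((- 1) ^ i :: int)"
  have "(\<Otimes>i\<in>{..n}. h (Suc i) [^] ((- 1) ^ Suc i :: int)) \<otimes> (\<Otimes>i\<in>{..n}. ?s i) =
      (\<Otimes>i\<in>{..n}. h (Suc i) [^] ((- 1) ^ Suc i :: int) \<otimes> ?s i)"
    using assms by (subst finprod_multf) (auto simp: Pi_def)
  also have "\<dots> = \<one>"
    using assms by (intro finprod_one_eqI) (auto simp: int_pow_neg)
  finally have "(\<Otimes>i\<in>{..n}. h (Suc i) [^] ((- 1) ^ Suc i :: int)) = inv altprod G (\<lambda>i. h (Suc i)) n"
    using assms by (intro inv_equality[symmetric]) (auto simp: altprod_def intro!: finprod_closed)
  moreover have "altprod G h (Suc n) =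
      (\<Otimes>i\<in>{..n}. h (Suc i) [^] ((- 1) ^ Suc i :: int)) \<otimes> h 0 [^] ((- 1) ^ 0 :: int)"
    unfolding altprod_def using assms by (subst finprod_Suc2) (auto simp: Pi_def)
  ultimately show ?thesis
    using assms by (simp add: int_pow_1 m_comm)
qed

lemma altprod_hom:
  assumes H: "comm_group H" and \<phi>: "\<phi> \<in> hom G H" and "\<And>i. i \<le> n \<Longrightarrow> h i \<in> carrier G"
  shows "\<phi> (altprod G h n) = altprod H (\<lambda>i. \<phi> (h i)) n"
  using assms(3)
proof (induction n arbitrary: h)
  case 0
  interpret H: comm_group H by fact
  show ?case using 0 \<phi> by (simp add: hom_in_carrier)
next
  case (Suc n)
  interpret H: comm_group H by fact
  interpret group_hom G H \<phi> using \<phi> by unfold_locales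
  show ?case
    using Suc by (simp add: altprod_Suc H.altprod_Suc)
qed

text \<open>Induction on \<open>n\<close>: the terms with \<open>i = 0\<close> cancel those with \<open>j = 0\<close>, \<open>i > 0\<close>, and
  the remaining ones satisfy the same identities.\<close>

lemma altprod_altprod:
  assumes "\<And>i j. i \<le> Suc n \<Longrightarrow> j \<le> n \<Longrightarrow> x i j \<in> carrier G"
    and "\<And>i j. i \<le> n \<Longrightarrow> j \<le> i \<Longrightarrow> x (Suc i) j = x j i"
  shows "altprod G (\<lambda>i. altprod G (x i) n) (Suc n) = \<one>"
  using assms
proof (induction n arbitrary: x)
  case 0
  then show ?case by (simp add: altprod_Suc)
next
  case (Suc n)
  let ?y = "\<lambda>i j. x (Suc i) (Suc j)"
  \<comment> \<open>By \<open>altprod_Suc\<close> row \<open>Suc i\<close> is its entry in column 0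
    times the inverse of the alternating product of the rest. Solving for that entry trades column 0
    for the full rows and the block \<open>?y\<close>, to which the induction hypothesis
    applies.\<close>
  have "altprod G (\<lambda>i. x (Suc i) 0) (Suc n) =
      altprod G (\<lambda>i. altprod G (x (Suc i)) (Suc n) \<otimes> altprod G (?y i) n) (Suc n)"
    using Suc.prems(1) by (intro altprod_cong) (simp_all add: altprod_Suc m_assoc)
  also have "\<dots> = altprod G (\<lambda>i. altprod G (x (Suc i)) (Suc n)) (Suc n) \<otimes>
      altprod G (\<lambda>i. altprod G (?y i) n) (Suc n)"
    using Suc.prems(1) by (intro altprod_mult) simp_all
  also have "altprod G (\<lambda>i. altprod G (?y i) n) (Suc n) = \<one>"
    by (intro Suc.IH) (simp_all add: Suc.prems)
  finally have "altprod G (\<lambda>i. altprod G (x (Suc i)) (Suc n)) (Suc n) = altprod G (\<lambda>i. x (Suc i) 0) (Suc n)"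
    using Suc.prems(1) by simp
  \<comment> \<open>The symmetry with \<open>j = 0\<close> identifies column 0 below the top row
    with row 0. So row 0 equals the alternating product of the other rows, and both cancel in
    \<open>altprod_Suc\<close>.\<close>
  also have "\<dots> = altprod G (x 0) (Suc n)"
    using Suc.prems by (intro altprod_cong) auto
  finally show ?case
    using Suc.prems(1) by (subst altprod_Suc) simp_all
qed

end

section \<open>Faces of tuples and the coboundary\<close>

text \<open>Positions count from 0, so \<open>merge S i\<close> is
  \<open>merge_at S (Suc i)\<close>. The last clause leaves lists that are too short unchanged, so
  that \<open>merge_closed\<close> and \<open>mprod_merge\<close> need no bound on
  \<open>i\<close>.\<close>

fun merge :: "('a, 'm) monoid_scheme \<Rightarrow> nat \<Rightarrow> 'a list \<Rightarrow> 'a list" where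
  "merge S 0 (a # b # as) = (a \<otimes>\<^bsub>S\<^esub> b) # as"
| "merge S (Suc i) (a # as) = a # merge S i as"
| "merge S _ as = as"

lemma length_merge: "Suc i < length as \<Longrightarrow> length (merge S i as) = length as - 1"
  by (induction S i as rule: merge.induct) auto

lemma merge_append: "Suc i < length as \<Longrightarrow> merge S i (as @ bs) = merge S i as @ bs"
  by (induction S i as rule: merge.induct) auto

lemma merge_snoc_last:
  "as \<noteq> [] \<Longrightarrow> merge S (length as - 1) (as @ [b]) = butlast as @ [last as \<otimes>\<^bsub>S\<^esub> b]"
  by (induction as rule: induct_list012) auto

lemma merge_eq_merge_at: "Suc i < length as \<Longrightarrow> merge S i as = merge_at S (Suc i) as"
  by (induction S i as rule: merge.induct) (auto simp: merge_at_def)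

context monoid
begin

lemma merge_closed: "set as \<subseteq> carrier G \<Longrightarrow> set (merge G i as) \<subseteq> carrier G"
proof (induction as arbitrary: i)
  case (Cons a as)
  then show ?case by (cases i; cases as) auto
qed (cases i; simp)

text \<open>The simplicial identity for faces, which is the symmetry that
  \<open>altprod_altprod\<close> asks for. Merges at disjoint places commute; only
  \<open>i = j\<close> needs associativity.\<close>

lemma merge_merge:
  "\<lbrakk>set as \<subseteq> carrier G; j \<le> i; Suc (Suc i) < length as\<rbrakk>
    \<Longrightarrow> merge G j (merge G (Suc i) as) = merge G i (merge G j as)"
proof (induction as arbitrary: i j)
  case (Cons a as)
  then obtain b c bs where as: "as = b # c # bs"
    by (cases as rule: remdups_adj.cases) auto
  show ?case
  proof (cases j)
    case 0
    then show ?thesis using Cons.prems as by (cases i) (auto simp: m_assoc)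
  next
    case (Suc j')
    then obtain i' where "i = Suc i'" using Cons.prems by (cases i) auto
    then show ?thesis using Cons Suc by auto
  qed
qed simp

lemma mprod_Nil [simp]: "mprod G [] = \<one>"
  and mprod_Cons [simp]: "mprod G (a # as) = a \<otimes> mprod G as"
  by (simp_all add: mprod_def)

lemma mprod_closed [simp]: "set as \<subseteq> carrier G \<Longrightarrow> mprod G as \<in> carrier G"
  by (induction as) auto

lemma mprod_append:
  "\<lbrakk>set as \<subseteq> carrier G; set bs \<subseteq> carrier G\<rbrakk> \<Longrightarrow> mprod G (as @ bs) = mprod G as \<otimes> mprod G bs"
  by (induction as) (auto simp: m_assoc)

lemma mprod_merge: "set as \<subseteq> carrier G \<Longrightarrow> mprod G (merge G i as) = mprod G as"
proof (induction as arbitrary: i)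
  case (Cons a as)
  then show ?case by (cases i; cases as) (auto simp: m_assoc)
qed (cases i; simp)

text \<open>Brings inner and outer faces into one shape: the first face takes
  \<open>d = \<one>\<close>, the last one \<open>c = \<one>\<close>, an inner one both. Since
  \<open>c\<close>, \<open>bs\<close>, \<open>d\<close> do not depend on \<open>u\<close> and
  \<open>v\<close>, the same face can be compared for two choices of outer entries in
  \<open>bar_coboundary\<close>.\<close>

lemma merge_cases:
  assumes as: "set as \<subseteq> carrier G" and i: "i \<le> length as" and ne: "as \<noteq> []"
  obtains c bs d where "c \<in> carrier G" "d \<in> carrier G" "set bs \<subseteq> carrier G"
    "Suc (length bs) = length as" "c \<otimes> mprod G bs \<otimes> d = mprod G as"
    "\<And>u v. \<lbrakk>u \<in> carrier G; v \<in> carrier G\<rbrakk>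
       \<Longrightarrow> merge G i (u # as @ [v]) = (u \<otimes> c) # bs @ [d \<otimes> v]"
proof -
  consider "i = 0" | "i = length as" "i \<noteq> 0" | j where "i = Suc j" "Suc j < length as"
    using i by (metis le_neq_implies_less not0_implies_Suc)
  then show ?thesis
  proof cases
    case 1
    obtain a bs where bs: "as = a # bs" using ne by (cases as) auto
    show ?thesis by (rule that[of a \<one> bs]) (use as bs 1 in simp_all)
  next
    case 2
    obtain bs a where bs: "as = bs @ [a]" using ne by (cases as rule: rev_cases) auto
    have *: "merge G (length bs) (bs @ [a, v]) = bs @ [a \<otimes> v]" for v
      using merge_snoc_last[of "bs @ [a]" G v] by simp
    show ?thesis
      by (rule that[of \<one> a bs]) (use as bs 2 * in \<open>simp_all add: mprod_append\<close>)
  next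
    case 3
    show ?thesis
      by (rule that[of \<one> \<one> "merge G j as"])
        (use as 3 in \<open>simp_all add: merge_closed mprod_merge length_merge merge_append\<close>)
  qed
qed

end

text \<open>The term of the two-sided bar construction at a tuple \<open>(u, a\<^sub>1, \<dots>, a\<^sub>n, v)\<close>: with the outer
  entries included, all faces of a cochain have the same form.\<close>

definition bar :: "('a, 'm) monoid_scheme \<Rightarrow> ('a \<times> 'a \<times> 'a \<Rightarrow> 'b \<Rightarrow> 'b) \<Rightarrow> ('a list \<Rightarrow> 'b) \<Rightarrow> 'a list \<Rightarrow> 'b" where
  "bar S T f as = T (hd as, mprod S (butlast (tl as)), last as) (f (butlast (tl as)))"

lemma bar_Cons_snoc [simp]: "bar S T f (u # as @ [v]) = T (u, mprod S as, v) (f as)"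
  by (simp add: bar_def)

context monoid_with_zero
begin

text \<open>As \<open>z\<close> absorbs, a factor with product \<open>z\<close> would make the whole
  product \<open>z\<close>. This ensures that the contiguous parts of a tuple have products that are
  objects of the category of factorizations.\<close>

lemma Ner_factor:
  assumes "as @ bs @ cs \<in> Ner S z n"
  shows "bs \<in> Ner S z (length bs)"
proof -
  have "x \<otimes> (z \<otimes> y) = z" if "x \<in> carrier S" "y \<in> carrier S" for x y
    using that by (simp add: zero_left zero_right)
  moreover have "mprod S as \<otimes> (mprod S bs \<otimes> mprod S cs) \<noteq> z"
      "mprod S as \<in> carrier S" "mprod S cs \<in> carrier S"
    using assms by (auto simp: Ner_def mprod_append)
  ultimately show ?thesis
    using assms by (auto simp: Ner_def)
qed

lemma Ner_ConsD:
  assumes "a # as \<in> Ner S z (Suc n)"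
  shows "as \<in> Ner S z n" "a \<in> carrier S" "a \<noteq> z"
  using assms Ner_factor[of "[a]" as "[]"] Ner_factor[of "[]" "[a]" as] by (auto simp: Ner_def)

lemma Ner_snocD:
  assumes "as @ [a] \<in> Ner S z (Suc n)"
  shows "as \<in> Ner S z n" "a \<in> carrier S" "a \<noteq> z"
  using assms Ner_factor[of "[]" as "[a]"] Ner_factor[of as "[a]" "[]"] by (auto simp: Ner_def)

lemma Ner_outer_cases:
  assumes "as \<in> Ner S z (Suc (Suc n))"
  obtains u bs v where "as = u # bs @ [v]" "u \<in> carrier S" "v \<in> carrier S" "bs \<in> Ner S z n"
proof -
  have len: "length as = Suc (Suc n)" using assms by (simp add: Ner_def)
  then obtain u cs where u: "as = u # cs" by (cases as) auto
  with len obtain bs v where v: "cs = bs @ [v]" by (cases cs rule: rev_cases) auto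
  show ?thesis
    by (rule that[of u bs v]) (use assms Ner_ConsD[of u cs "Suc n"] Ner_snocD[of bs v n] u v in simp_all)
qed

lemma Ner_merge: "\<lbrakk>as \<in> Ner S z (Suc n); i < n\<rbrakk> \<Longrightarrow> merge S i as \<in> Ner S z n"
  using merge_closed[of as i] by (simp add: Ner_def length_merge mprod_merge)

lemma Ner_extend: "as \<in> Ner S z n \<Longrightarrow> \<one> # as @ [\<one>] \<in> Ner S z (Suc (Suc n))"
  by (auto simp: Ner_def mprod_append)

lemma mprod_extend: "as \<in> Ner S z n \<Longrightarrow> mprod S (\<one> # as @ [\<one>]) = mprod S as"
  by (simp add: Ner_def mprod_append)

lemma Ner_fac_obj: "as \<in> Ner S z n \<Longrightarrow> mprod S as \<in> fac_obj S z"
  by (simp add: Ner_def fac_obj_def)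

end

section \<open>The cochain complex of a natural system\<close>

context natural_system
begin

lemma comm_group_Ner: "as \<in> Ner S z n \<Longrightarrow> comm_group (D (mprod S as))"
  by (simp add: comm_group_D Ner_fac_obj)

lemma group_cochain_group: "group (cochain_group S z D n)"
  unfolding cochain_group_def
  using comm_group_Ner comm_group.axioms(2) by (intro product_group) blast

lemma cochain_closed:
  "\<lbrakk>f \<in> carrier (cochain_group S z D n); as \<in> Ner S z n\<rbrakk> \<Longrightarrow> f as \<in> carrier (D (mprod S as))"
  by (auto simp: cochain_group_def)

lemma T_hom_outer:
  assumes "u # as @ [v] \<in> Ner S z (Suc (Suc n))"
  shows "T (u, mprod S as, v) \<in> hom (D (mprod S as)) (D (mprod S (u # as @ [v])))"
proof (rule T_hom)
  have *: "set as \<subseteq> carrier S" "u \<in> carrier S" "v \<in> carrier S"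
    using assms by (auto simp: Ner_def)
  show "mprod S as \<in> fac_obj S z" "mprod S (u # as @ [v]) \<in> fac_obj S z"
    using Ner_factor[of "[u]" as "[v]"] assms Ner_fac_obj by (metis append_Cons append_Nil)+
  show "(u, mprod S as, v) \<in> fac_mor S (mprod S as) (mprod S (u # as @ [v]))"
    using * by (simp add: fac_mor_def mprod_append m_assoc)
qed

text \<open>Functoriality along tuples. The longest tuple lies in \<open>Ner\<close>, so by
  \<open>Ner_factor\<close> all three products are objects and \<open>T_comp\<close>
  applies.\<close>

lemma T_T:
  assumes "u # c # as @ [d, v] \<in> Ner S z n" and x: "x \<in> carrier (D (mprod S as))"
  shows "T (u, mprod S (c # as @ [d]), v) (T (c, mprod S as, d) x) = T (u \<otimes> c, mprod S as, d \<otimes> v) x"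
proof -
  have *: "set as \<subseteq> carrier S" "u \<in> carrier S" "v \<in> carrier S" "c \<in> carrier S" "d \<in> carrier S"
    using assms by (auto simp: Ner_def)
  have obj: "mprod S as \<in> fac_obj S z" "mprod S (c # as @ [d]) \<in> fac_obj S z"
      "mprod S (u # c # as @ [d, v]) \<in> fac_obj S z"
    using Ner_factor[of "[u, c]" as "[d, v]"] Ner_factor[of "[u]" "c # as @ [d]" "[v]"] assms(1)
    by (metis append_Cons append_Nil append_assoc Ner_fac_obj)+
  show ?thesis
    using T_comp[OF obj _ _ x, of "(c, mprod S as, d)" "(u, mprod S (c # as @ [d]), v)"] *
    by (simp add: fac_mor_def mprod_append m_assoc)
qed

lemma bar_closed:
  assumes f: "f \<in> carrier (cochain_group S z D n)" and as: "as \<in> Ner S z (Suc (Suc n))"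
  shows "bar S T f as \<in> carrier (D (mprod S as))"
  using as
proof (cases rule: Ner_outer_cases)
  case (1 u bs v)
  then show ?thesis
    using hom_in_carrier[OF T_hom_outer cochain_closed] f as by (metis bar_Cons_snoc)
qed

lemma bar_merge_closed:
  assumes "f \<in> carrier (cochain_group S z D n)" "as \<in> Ner S z (Suc (Suc (Suc n)))" "i \<le> Suc n"
  shows "bar S T f (merge S i as) \<in> carrier (D (mprod S as))"
  using bar_closed[OF assms(1) Ner_merge[OF assms(2)]] assms by (simp add: mprod_merge Ner_def)

lemma bar_extend:
  assumes f: "f \<in> carrier (cochain_group S z D n)" and as: "as \<in> Ner S z n"
  shows "bar S T f (\<one> # as @ [\<one>]) = f as"
  using T_id[OF Ner_fac_obj[OF as] cochain_closed[OF f as]] by simp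

text \<open>Padding with \<open>\<one>\<close> makes the formula uniform: face 0 moves the first
  entry to the left outer place, where it acts through \<open>T\<close>; the last face does the same
  on the right; an inner face keeps both outer \<open>\<one>\<close>, which act trivially.\<close>

lemma coboundary_eq:
  assumes f: "f \<in> carrier (cochain_group S z D n)" and as: "as \<in> Ner S z (Suc n)"
  shows "coboundary S z D T n f as =
    altprod (D (mprod S as)) (\<lambda>i. bar S T f (merge S i (\<one> # as @ [\<one>]))) (Suc n)"
proof -
  define h where "h = (\<lambda>i. bar S T f (merge S i (\<one> # as @ [\<one>])))"
  interpret G: comm_group "D (mprod S as)" using as by (rule comm_group_Ner)
  have len: "length as = Suc n" and set: "set as \<subseteq> carrier S"
    using as by (auto simp: Ner_def)
  have h [simp]: "h i \<in> carrier (D (mprod S as))" if "i \<le> Suc n" for i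
    using bar_merge_closed[OF f Ner_extend[OF as] that] as mprod_extend[OF as] by (simp add: h_def)
  have "h 0 = T (hd as, mprod S (tl as), \<one>) (f (tl as))"
    using len set by (cases as) (auto simp: h_def)
  moreover
  have inner: "h i = f (merge_at S i as)" if i: "i \<in> {Suc 0..n}" for i
  proof -
    obtain j where j: "i = Suc j" "j < n" using i by (cases i) auto
    then have "merge S i (\<one> # as @ [\<one>]) = \<one> # merge S j as @ [\<one>]"
      using len by (simp add: merge_append)
    moreover have "merge S j as \<in> Ner S z n" using as j by (simp add: Ner_merge)
    ultimately show ?thesis
      using bar_extend[OF f] j len by (simp add: h_def merge_eq_merge_at)
  qed
  have "(\<Otimes>\<^bsub>D (mprod S as)\<^esub>i\<in>{1..n}. f (merge_at S i as) [^]\<^bsub>D (mprod S as)\<^esub> ((- 1) ^ i :: int)) =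
      (\<Otimes>\<^bsub>D (mprod S as)\<^esub>i\<in>{Suc 0..n}. h i [^]\<^bsub>D (mprod S as)\<^esub> ((- 1) ^ i :: int))"
    by (rule G.finprod_cong') (simp_all add: inner[symmetric] Pi_def)
  moreover have "h (Suc n) = T (\<one>, mprod S (butlast as), last as) (f (butlast as))"
  proof -
    obtain bs a where "as = bs @ [a]" using len by (cases as rule: rev_cases) auto
    then show ?thesis
      using merge_snoc_last[of as S \<one>] len set by (simp add: h_def)
  qed
  ultimately have *: "coboundary S z D T n f as = h 0 \<otimes>\<^bsub>D (mprod S as)\<^esub>
      (\<Otimes>\<^bsub>D (mprod S as)\<^esub>i\<in>{Suc 0..n}. h i [^]\<^bsub>D (mprod S as)\<^esub> ((- 1) ^ i :: int)) \<otimes>\<^bsub>D (mprod S as)\<^esub>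
      h (Suc n) [^]\<^bsub>D (mprod S as)\<^esub> ((- 1) ^ Suc n :: int)"
    using as by (simp add: coboundary_def Let_def)
  have "altprod (D (mprod S as)) h (Suc n) = h (Suc n) [^]\<^bsub>D (mprod S as)\<^esub> ((- 1) ^ Suc n :: int)
      \<otimes>\<^bsub>D (mprod S as)\<^esub> (h 0 [^]\<^bsub>D (mprod S as)\<^esub> ((- 1) ^ 0 :: int) \<otimes>\<^bsub>D (mprod S as)\<^esub>
      (\<Otimes>\<^bsub>D (mprod S as)\<^esub>i\<in>{Suc 0..n}. h i [^]\<^bsub>D (mprod S as)\<^esub> ((- 1) ^ i :: int)))"
    unfolding altprod_def
    using G.finprod_0'[of "\<lambda>i. h i [^]\<^bsub>D (mprod S as)\<^esub> ((- 1) ^ i :: int)" n]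
    by (subst G.finprod_Suc) (auto simp: Pi_def)
  then show ?thesis
    unfolding * h_def[symmetric] by (simp add: G.int_pow_1 G.m_comm Pi_def)
qed

lemma coboundary_closed:
  assumes f: "f \<in> carrier (cochain_group S z D n)"
  shows "coboundary S z D T n f \<in> carrier (cochain_group S z D (Suc n))"
proof -
  have "coboundary S z D T n f as \<in> carrier (D (mprod S as))" if as: "as \<in> Ner S z (Suc n)" for as
  proof -
    interpret G: comm_group "D (mprod S as)" using as by (rule comm_group_Ner)
    show ?thesis
      using bar_merge_closed[OF f Ner_extend[OF as]] as mprod_extend[OF as]
      by (simp add: coboundary_eq[OF f as])
  qed
  then show ?thesis
    by (auto simp: cochain_group_def coboundary_def)
qed

text \<open>\<open>T (u, _, v)\<close> is a homomorphism and passes through the alternating product;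
  on each face it composes with the action of the outer entries \<open>c\<close> and
  \<open>d\<close> to that of \<open>u c\<close> and \<open>d v\<close>. So a coboundary can be
  expanded a second time inside \<open>bar\<close>.\<close>

lemma bar_coboundary:
  assumes f: "f \<in> carrier (cochain_group S z D n)" and as: "as \<in> Ner S z (Suc (Suc (Suc n)))"
  shows "bar S T (coboundary S z D T n f) as = altprod (D (mprod S as)) (\<lambda>i. bar S T f (merge S i as)) (Suc n)"
  using as
proof (cases rule: Ner_outer_cases)
  case (1 u bs v)
  interpret G: comm_group "D (mprod S as)" using as by (rule comm_group_Ner)
  interpret H: comm_group "D (mprod S bs)" using 1(4) by (rule comm_group_Ner)
  have bs: "length bs = Suc n" "set bs \<subseteq> carrier S" "bs \<noteq> []" using 1 by (auto simp: Ner_def)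
  have closed: "bar S T f (merge S i (\<one> # bs @ [\<one>])) \<in> carrier (D (mprod S bs))" if "i \<le> Suc n" for i
    using bar_merge_closed[OF f Ner_extend[OF 1(4)] that] mprod_extend[OF 1(4)] by simp
  have hom: "T (u, mprod S bs, v) \<in> hom (D (mprod S bs)) (D (mprod S as))"
    using T_hom_outer as 1 by blast
  have "bar S T (coboundary S z D T n f) as =
      T (u, mprod S bs, v) (altprod (D (mprod S bs)) (\<lambda>i. bar S T f (merge S i (\<one> # bs @ [\<one>]))) (Suc n))"
    using 1 by (simp add: coboundary_eq[OF f])
  also have "\<dots> = altprod (D (mprod S as)) (\<lambda>i. T (u, mprod S bs, v) (bar S T f (merge S i (\<one> # bs @ [\<one>])))) (Suc n)"
    using closed by (intro H.altprod_hom[OF G.comm_group_axioms hom])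
  also have "\<dots> = altprod (D (mprod S as)) (\<lambda>i. bar S T f (merge S i as)) (Suc n)"
  proof (rule G.altprod_cong)
    fix i assume i: "i \<le> Suc n"
    then have "i \<le> length bs" using bs by simp
    from merge_cases[OF bs(2) this bs(3)] obtain c cs d where c: "c \<in> carrier S" "d \<in> carrier S"
      "set cs \<subseteq> carrier S" "Suc (length cs) = length bs" "c \<otimes> mprod S cs \<otimes> d = mprod S bs"
      and eq: "\<And>u v. \<lbrakk>u \<in> carrier S; v \<in> carrier S\<rbrakk>
       \<Longrightarrow> merge S i (u # bs @ [v]) = (u \<otimes> c) # cs @ [d \<otimes> v]"
      by metis
    have prod: "mprod S (c # cs @ [d]) = mprod S bs"
      using c by (simp add: mprod_append m_assoc)
    have "mprod S (u # c # cs @ [d, v]) = u \<otimes> (c \<otimes> mprod S cs \<otimes> d) \<otimes> v"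
      using c(1-3) 1(2,3) by (simp add: mprod_append m_assoc)
    also have "\<dots> = mprod S as"
      unfolding c(5) using 1 bs by (simp add: mprod_append m_assoc)
    finally have Ner: "u # c # cs @ [d, v] \<in> Ner S z (length (u # c # cs @ [d, v]))"
      using c 1 as by (simp add: Ner_def)
    have "cs \<in> Ner S z n"
      using Ner_factor[of "[u, c]" cs "[d, v]"] Ner c bs by simp
    then show "T (u, mprod S bs, v) (bar S T f (merge S i (\<one> # bs @ [\<one>]))) = bar S T f (merge S i as)"
      using T_T[OF Ner cochain_closed[OF f]] c 1 eq prod by simp
  qed (use bar_merge_closed[OF f as] in blast)
  finally show ?thesis .
qed

text \<open>Two expansions give an alternating product of double faces, which cancels by
  \<open>altprod_altprod\<close> because of \<open>merge_merge\<close>.\<close>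

lemma coboundary_coboundary:
  assumes f: "f \<in> carrier (cochain_group S z D n)"
  shows "coboundary S z D T (Suc n) (coboundary S z D T n f) = \<one>\<^bsub>cochain_group S z D (Suc (Suc n))\<^esub>"
proof -
  have "coboundary S z D T (Suc n) (coboundary S z D T n f) as = \<one>\<^bsub>D (mprod S as)\<^esub>"
    if as: "as \<in> Ner S z (Suc (Suc n))" for as
  proof -
    define bs where "bs = \<one> # as @ [\<one>]"
    have bs: "bs \<in> Ner S z (Suc (Suc (Suc (Suc n))))" and mbs: "mprod S bs = mprod S as"
      using Ner_extend[OF as] mprod_extend[OF as] by (simp_all add: bs_def)
    then have len: "length bs = Suc (Suc (Suc (Suc n)))" and set: "set bs \<subseteq> carrier S"
      by (auto simp: Ner_def)
    interpret G: comm_group "D (mprod S as)" using as by (rule comm_group_Ner)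
    have x: "bar S T f (merge S j (merge S i bs)) \<in> carrier (D (mprod S as))"
      if "i \<le> Suc (Suc n)" "j \<le> Suc n" for i j
      using bar_merge_closed[OF f Ner_merge[OF bs] that(2)] that set mbs by (simp add: mprod_merge)
    have "coboundary S z D T (Suc n) (coboundary S z D T n f) as =
        altprod (D (mprod S as)) (\<lambda>i. bar S T (coboundary S z D T n f) (merge S i bs)) (Suc (Suc n))"
      unfolding bs_def by (rule coboundary_eq[OF coboundary_closed[OF f] as])
    also have "\<dots> = altprod (D (mprod S as))
        (\<lambda>i. altprod (D (mprod S as)) (\<lambda>j. bar S T f (merge S j (merge S i bs))) (Suc n)) (Suc (Suc n))"
      using bar_coboundary[OF f Ner_merge[OF bs]] set mbs x
      by (intro G.altprod_cong) (simp_all add: mprod_merge)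
    also have "\<dots> = \<one>\<^bsub>D (mprod S as)\<^esub>"
      using x len set by (intro G.altprod_altprod) (simp_all add: merge_merge)
    finally show ?thesis .
  qed
  then show ?thesis
    by (auto simp: cochain_group_def coboundary_def fun_eq_iff)
qed

lemma coboundary_hom:
  "coboundary S z D T n \<in> hom (cochain_group S z D n) (cochain_group S z D (Suc n))"
proof (rule homI)
  fix f g
  assume f: "f \<in> carrier (cochain_group S z D n)" and g: "g \<in> carrier (cochain_group S z D n)"
  interpret C: group "cochain_group S z D n" by (rule group_cochain_group)
  let ?fg = "f \<otimes>\<^bsub>cochain_group S z D n\<^esub> g"
  have fg: "?fg \<in> carrier (cochain_group S z D n)" using f g by blast
  have bar: "bar S T ?fg as = bar S T f as \<otimes>\<^bsub>D (mprod S as)\<^esub> bar S T g as"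
    if as: "as \<in> Ner S z (Suc (Suc n))" for as
    using as
  proof (cases rule: Ner_outer_cases)
    case (1 u bs v)
    have "T (u, mprod S bs, v) \<in> hom (D (mprod S bs)) (D (mprod S as))"
      using T_hom_outer as 1 by blast
    from hom_mult[OF this cochain_closed[OF f] cochain_closed[OF g]] show ?thesis
      using 1 by (simp add: cochain_group_def)
  qed
  have "coboundary S z D T n ?fg as =
      coboundary S z D T n f as \<otimes>\<^bsub>D (mprod S as)\<^esub> coboundary S z D T n g as"
    if as: "as \<in> Ner S z (Suc n)" for as
  proof -
    interpret G: comm_group "D (mprod S as)" using as by (rule comm_group_Ner)
    let ?m = "\<lambda>i. merge S i (\<one> # as @ [\<one>])"
    have Ner: "?m i \<in> Ner S z (Suc (Suc n))" and mprod: "mprod S (?m i) = mprod S as" if "i \<le> Suc n" for i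
      using Ner_merge[OF Ner_extend[OF as]] that mprod_extend[OF as] Ner_extend[OF as]
      by (simp_all add: mprod_merge Ner_def)
    have "coboundary S z D T n ?fg as =
        altprod (D (mprod S as)) (\<lambda>i. bar S T f (?m i) \<otimes>\<^bsub>D (mprod S as)\<^esub> bar S T g (?m i)) (Suc n)"
      unfolding coboundary_eq[OF fg as]
      using bar_closed[OF f Ner] bar_closed[OF g Ner] bar[OF Ner] mprod
      by (intro G.altprod_cong) simp_all
    then show ?thesis
      using bar_closed[OF f Ner] bar_closed[OF g Ner] mprod
      by (simp add: coboundary_eq[OF f as] coboundary_eq[OF g as] G.altprod_mult)
  qed
  then show "coboundary S z D T n ?fg =
      coboundary S z D T n f \<otimes>\<^bsub>cochain_group S z D (Suc n)\<^esub> coboundary S z D T n g"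
    by (auto simp: cochain_group_def coboundary_def fun_eq_iff)
qed (rule coboundary_closed)

lemma coboundary_group_hom:
  "group_hom (cochain_group S z D n) (cochain_group S z D (Suc n)) (coboundary S z D T n)"
  by (simp add: group_hom_def group_hom_axioms_def group_cochain_group coboundary_hom)

lemma cocycle_iff:
  "f \<in> cocycles S z D T n \<longleftrightarrow> f \<in> carrier (cochain_group S z D n) \<and>
    (\<forall>as\<in>Ner S z (Suc n). coboundary S z D T n f as = \<one>\<^bsub>D (mprod S as)\<^esub>)"
  using coboundary_closed[of f n]
  by (auto simp: cocycles_def kernel_def cochain_group_def fun_eq_iff PiE_iff extensional_def)

text \<open>Since every coboundary is a cocycle, the assumed inclusion is an equality, and the
  cohomology group becomes the group of cocycles modulo itself.\<close>

lemma trivial_cohomology_groupI: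
  assumes "cocycles S z D T (Suc n) \<subseteq> coboundaries S z D T (Suc n)"
  shows "trivial_group (cohomology_group S z D T (Suc n))"
proof -
  interpret group_hom "cochain_group S z D (Suc n)" "cochain_group S z D (Suc (Suc n))" "coboundary S z D T (Suc n)"
    by (rule coboundary_group_hom)
  let ?Z = "(cochain_group S z D (Suc n))\<lparr>carrier := cocycles S z D T (Suc n)\<rparr>"
  have "coboundaries S z D T (Suc n) \<subseteq> cocycles S z D T (Suc n)"
    using coboundary_coboundary coboundary_closed
    by (auto simp: coboundaries_def cocycles_def kernel_def)
  with assms have eq: "coboundaries S z D T (Suc n) = carrier ?Z" by auto
  interpret Z: group ?Z
    unfolding cocycles_def by (rule subgroup.subgroup_is_group[OF subgroup_kernel G.is_group])
  have group: "group (?Z Mod carrier ?Z)"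
    by (rule normal.factorgroup_is_group[OF Z.normal_self])
  obtain \<phi> where "\<phi> \<in> iso (?Z Mod carrier ?Z) (?Z\<lparr>carrier := {\<one>\<^bsub>?Z\<^esub>}\<rparr>)"
    using Z.self_factor_iso by blast
  then have iso: "?Z Mod carrier ?Z \<cong> ?Z\<lparr>carrier := {\<one>\<^bsub>?Z\<^esub>}\<rparr>"
    by (rule is_isoI)
  have triv: "trivial_group (?Z\<lparr>carrier := {\<one>\<^bsub>?Z\<^esub>}\<rparr>)"
    using subgroup.subgroup_is_group[OF Z.triv_subgroup Z.is_group] by (simp add: trivial_group_def)
  show ?thesis
    unfolding cohomology_group_def eq
    using isomorphic_group_triviality[OF iso group] triv trivial_group_def by blast
qed

end

section \<open>Splitting off the first letter\<close>

text \<open>A zero-free monoid as seen from the left: \<open>p\<close> is the first letter of a nonzero element, \<open>q\<close>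
  the rest of the word.\<close>

locale letter_splitting = monoid_with_zero S z for S :: "('a, 'm) monoid_scheme" (structure) and z +
  fixes len :: "'a \<Rightarrow> nat" and p q :: "'a \<Rightarrow> 'a"
  assumes len_eq_0: "a \<in> carrier S \<Longrightarrow> a \<noteq> z \<Longrightarrow> len a = 0 \<longleftrightarrow> a = \<one>"
    and p_closed: "a \<in> carrier S \<Longrightarrow> a \<noteq> z \<Longrightarrow> a \<noteq> \<one> \<Longrightarrow> p a \<in> carrier S"
    and q_closed: "a \<in> carrier S \<Longrightarrow> a \<noteq> z \<Longrightarrow> a \<noteq> \<one> \<Longrightarrow> q a \<in> carrier S"
    and p_mult_q: "a \<in> carrier S \<Longrightarrow> a \<noteq> z \<Longrightarrow> a \<noteq> \<one> \<Longrightarrow> p a \<otimes> q a = a"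
    and len_q: "a \<in> carrier S \<Longrightarrow> a \<noteq> z \<Longrightarrow> a \<noteq> \<one> \<Longrightarrow> len a = Suc (len (q a))"
    and mult_ne_one: "\<lbrakk>a \<in> carrier S; b \<in> carrier S; a \<noteq> \<one>; a \<otimes> b \<noteq> z\<rbrakk> \<Longrightarrow> a \<otimes> b \<noteq> \<one>"
    and p_mult: "\<lbrakk>a \<in> carrier S; b \<in> carrier S; a \<noteq> \<one>; a \<otimes> b \<noteq> z\<rbrakk> \<Longrightarrow> p (a \<otimes> b) = p a"
    and q_mult: "\<lbrakk>a \<in> carrier S; b \<in> carrier S; a \<noteq> \<one>; a \<otimes> b \<noteq> z\<rbrakk> \<Longrightarrow> q (a \<otimes> b) = q a \<otimes> b"

text \<open>One argument for both kinds of 0-free monoid: \<open>K\<close> is the set of words that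
  stay nonzero, either the complement of the ideal or all words. Closure of \<open>K\<close> under
  factors keeps the first letter and the tail of a nonzero word nonzero.\<close>

lemma (in monoid_with_zero) letter_splitting_of_words:
  fixes R :: "'x list option monoid"
  assumes iso: "S \<cong> R" and one: "\<one> \<noteq> z" and carrier: "carrier R = insert None (Some ` K)"
    and factor: "\<And>u v. u @ v \<in> K \<Longrightarrow> u \<in> K \<and> v \<in> K"
    and mult: "\<And>u v. u \<in> K \<Longrightarrow> v \<in> K \<Longrightarrow>
      Some u \<otimes>\<^bsub>R\<^esub> Some v = (if u @ v \<in> K then Some (u @ v) else None)"
    and None: "\<And>x. x \<otimes>\<^bsub>R\<^esub> None = None"
  shows "\<exists>len p q. letter_splitting S z len p q"
proof -
  obtain h where h: "h \<in> iso S R" using iso by (auto simp: is_iso_def)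
  then have h_mult: "h (x \<otimes> y) = h x \<otimes>\<^bsub>R\<^esub> h y" if "x \<in> carrier S" "y \<in> carrier S" for x y
    using that by (auto simp: iso_def hom_def)
  have bij: "bij_betw h (carrier S) (carrier R)" using h by (simp add: iso_def)
  then have "None \<in> h ` carrier S" using carrier by (simp add: bij_betw_def)
  then obtain y where y: "y \<in> carrier S" "h y = None" by (metis imageE)
  \<comment> \<open>With \<open>y\<close> a preimage of \<open>None\<close>, the absorbing law
    \<open>z \<otimes> y = z\<close> is sent by \<open>h\<close> to a product with
    \<open>None\<close>.\<close>
  have hz: "h z = None"
    using h_mult[OF zero_closed y(1)] y zero_left[OF y(1)] None by simp
  define wd where "wd = (\<lambda>a. the (h a))"
  let ?O = "carrier S - {z}"
  have h_wd: "h a = Some (wd a)" "wd a \<in> K" if "a \<in> ?O" for a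
  proof -
    have ne: "h a \<noteq> None"
    proof
      assume "h a = None"
      then have "h a = h z" by (simp add: hz)
      then have "a = z"
        using bij that zero_closed inj_onD[of h "carrier S" a z] by (auto simp: bij_betw_def)
      then show False using that by simp
    qed
    then show *: "h a = Some (wd a)" by (simp add: wd_def)
    have "h a \<in> insert None (Some ` K)"
      using bij_betw_apply[OF bij, of a] that unfolding carrier by blast
    then show "wd a \<in> K" unfolding * by blast
  qed
  have inj: "a = b" if "a \<in> ?O" "b \<in> ?O" "wd a = wd b" for a b
    using bij that h_wd(1)[of a] h_wd(1)[of b] inj_onD[of h "carrier S" a b] by (simp add: bij_betw_def)
  have surj: "\<exists>a. a \<in> ?O \<and> wd a = w" if "w \<in> K" for w
  proof -
    have "Some w \<in> h ` carrier S" using bij carrier that by (simp add: bij_betw_def)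
    then obtain a where "a \<in> carrier S" "h a = Some w" by (metis imageE)
    then show ?thesis using hz by (intro exI[of _ a]) (auto simp: wd_def)
  qed
  define elt where "elt = (\<lambda>w. SOME a. a \<in> ?O \<and> wd a = w)"
  have elt: "elt w \<in> ?O" "wd (elt w) = w" if "w \<in> K" for w
    using someI_ex[OF surj[OF that]] by (simp_all add: elt_def)
  have ne: "a \<in> ?O" "b \<in> ?O" if "a \<in> carrier S" "b \<in> carrier S" "a \<otimes> b \<noteq> z" for a b
    using that zero_left[of b] zero_right[of a] by (cases "a = z"; cases "b = z"; simp)+
  have wd_mult: "wd (a \<otimes> b) = wd a @ wd b" if ab: "a \<in> carrier S" "b \<in> carrier S" "a \<otimes> b \<noteq> z" for a b
  proof -
    have "Some (wd (a \<otimes> b)) = Some (wd a) \<otimes>\<^bsub>R\<^esub> Some (wd b)"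
      using h_wd[OF ne(1)[OF ab]] h_wd[OF ne(2)[OF ab]] h_wd(1)[of "a \<otimes> b"] h_mult[of a b] ab by simp
    then show ?thesis
      using mult h_wd[OF ne(1)[OF ab]] h_wd[OF ne(2)[OF ab]] by (auto split: if_splits)
  qed
  have mult_ne: "a \<otimes> b \<noteq> z" if "a \<in> ?O" "b \<in> ?O" "wd a @ wd b \<in> K" for a b
    using that h_mult[of a b] hz mult[of "wd a" "wd b"] h_wd[of a] h_wd[of b] by auto
  \<comment> \<open>\<open>h\<close> is only known to be multiplicative, but \<open>\<one>\<close>
    is idempotent and \<open>[]\<close> is the only word \<open>w\<close> with
    \<open>w @ w = w\<close>.\<close>
  have wd_one: "wd \<one> = []"
    using wd_mult[of \<one> \<one>] one by simp
  have wd_Nil: "wd a = [] \<longleftrightarrow> a = \<one>" if "a \<in> ?O" for a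
    using inj[OF that, of \<one>] wd_one one by auto
  define p where "p = (\<lambda>a. elt [hd (wd a)])"
  define q where "q = (\<lambda>a. elt (tl (wd a)))"
  have K: "[hd (wd a)] \<in> K" "tl (wd a) \<in> K" if "a \<in> ?O" "a \<noteq> \<one>" for a
    using factor[of "[hd (wd a)]" "tl (wd a)"] h_wd(2)[OF that(1)] wd_Nil[OF that(1)] that(2) by simp_all
  show ?thesis
  proof (intro exI, unfold_locales)
    fix a assume "a \<in> carrier S" "a \<noteq> z"
    then have a: "a \<in> ?O" by simp
    show "length (wd a) = 0 \<longleftrightarrow> a = \<one>" using wd_Nil[OF a] by simp
    assume "a \<noteq> \<one>"
    note K = K[OF a this] and wd = wd_Nil[OF a] \<open>a \<noteq> \<one>\<close>
    show p: "p a \<in> carrier S" and q: "q a \<in> carrier S" using elt K by (auto simp: p_def q_def)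
    have "wd (p a) @ wd (q a) = wd a" using elt K wd by (simp add: p_def q_def)
    moreover from this have "p a \<otimes> q a \<noteq> z"
      using mult_ne[of "p a" "q a"] elt K h_wd(2)[OF a] by (simp add: p_def q_def)
    ultimately show "p a \<otimes> q a = a" using inj[of "p a \<otimes> q a" a] wd_mult[OF p q] a p q by simp
    show "length (wd a) = Suc (length (wd (q a)))" using elt K wd by (cases "wd a") (auto simp: q_def)
  next
    fix a b assume ab: "a \<in> carrier S" "b \<in> carrier S" "a \<otimes> b \<noteq> z" and a1: "a \<noteq> \<one>"
    note ne = ne[OF ab]
    have nil: "wd a \<noteq> []" using wd_Nil[OF ne(1)] a1 by simp
    show "a \<otimes> b \<noteq> \<one>" using nil wd_mult[OF ab] wd_one by auto
    show "p (a \<otimes> b) = p a" using nil wd_mult[OF ab] by (simp add: p_def)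
    have "wd (a \<otimes> b) = hd (wd a) # (tl (wd a) @ wd b)" using nil wd_mult[OF ab] by simp
    \<comment> \<open>The word of the nonzero product \<open>a \<otimes> b\<close> lies in
      \<open>K\<close>, hence so does its tail; this is what keeps \<open>q a \<otimes> b\<close>
      away from \<open>z\<close>.\<close>
    then have tK: "tl (wd a) @ wd b \<in> K"
      using h_wd(2)[of "a \<otimes> b"] factor[of "[hd (wd a)]" "tl (wd a) @ wd b"] ab by simp
    have q: "q a \<in> ?O" "wd (q a) = tl (wd a)" using elt K[OF ne(1) a1] by (simp_all add: q_def)
    have qb: "q a \<otimes> b \<noteq> z" using mult_ne[OF q(1) ne(2)] tK q(2) by simp
    have "q (a \<otimes> b) = elt (tl (wd a) @ wd b)" using nil wd_mult[OF ab] by (simp add: q_def)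
    moreover have "wd (q a \<otimes> b) = tl (wd a) @ wd b" using wd_mult[of "q a" b] q ab(2) qb by simp
    ultimately show "q (a \<otimes> b) = q a \<otimes> b"
      using inj[of "q (a \<otimes> b)" "q a \<otimes> b"] elt[OF tK] q(1) ab(2) qb by simp
  qed
qed

lemma letter_splitting_of_zero_free:
  assumes M: "monoid_with_zero M z" and one: "\<one>\<^bsub>M\<^esub> \<noteq> z" and "zero_free_on X M"
  shows "\<exists>len p q. letter_splitting M z len p q"
proof -
  from \<open>zero_free_on X M\<close> consider
    (rees) I where "two_sided_ideal (free_monoid X) I" "M \<cong> rees_factor (free_monoid X) I"
    | (adjoin) "M \<cong> adjoin_zero (free_monoid X)"
    by (auto simp: zero_free_on_def)
  then show ?thesis
  proof cases
    case rees
    have I: "I \<subseteq> lists X" "I \<noteq> {}"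
      using rees(1) by (auto simp: two_sided_ideal_def free_monoid_def)
    have ideal: "u @ v \<in> I" "v @ u \<in> I" if "u \<in> lists X" "v \<in> I" for u v
      using rees(1) that by (auto simp: two_sided_ideal_def free_monoid_def)
    show ?thesis
    proof (rule monoid_with_zero.letter_splitting_of_words[OF M rees(2) one, where K = "lists X - I"])
      have "rees_class I ` lists X = rees_class I ` I \<union> rees_class I ` (lists X - I)"
        using I by blast
      also have "rees_class I ` I = {None}"
        using I by (auto simp: rees_class_def)
      also have "rees_class I ` (lists X - I) = Some ` (lists X - I)"
        by (rule image_cong) (auto simp: rees_class_def)
      finally show "carrier (rees_factor (free_monoid X) I) = insert None (Some ` (lists X - I))"
        by (simp add: rees_factor_def free_monoid_def)
    next
      fix u v assume "u @ v \<in> lists X - I"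
      then show "u \<in> lists X - I \<and> v \<in> lists X - I"
        using ideal[of v u] ideal[of u v] by auto
    next
      fix u v assume "u \<in> lists X - I" "v \<in> lists X - I"
      then show "Some u \<otimes>\<^bsub>rees_factor (free_monoid X) I\<^esub> Some v =
          (if u @ v \<in> lists X - I then Some (u @ v) else None)"
        by (simp add: rees_factor_def rees_class_def free_monoid_def)
    next
      show "x \<otimes>\<^bsub>rees_factor (free_monoid X) I\<^esub> None = None" for x
        by (cases x) (simp_all add: rees_factor_def)
    qed
  next
    case adjoin
    show ?thesis
      by (rule monoid_with_zero.letter_splitting_of_words[OF M adjoin one, where K = "lists X"])
        (simp_all add: adjoin_zero_def free_monoid_def split: option.split)
  qed
qed

section \<open>Contraction of cocycles\<close>

text \<open>As \<open>c\<close> and \<open>bs\<close> do not depend on \<open>a\<close>, the same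
  face of \<open>a # as\<close> and of \<open>w # as\<close>, where \<open>a = x w\<close>, has
  first entry \<open>a c\<close> and \<open>w c\<close> respectively, and the same rest.\<close>

lemma (in monoid) merge_Cons_cases:
  assumes "set as \<subseteq> carrier G" "as \<noteq> []"
  obtains c bs where "c \<in> carrier G" "set bs \<subseteq> carrier G"
    "\<And>a. a \<in> carrier G \<Longrightarrow> merge G i (a # as) = (a \<otimes> c) # bs"
proof (cases i)
  case 0
  show ?thesis by (rule that[of "hd as" "tl as"]) (use 0 assms in \<open>cases as; simp\<close>)+
next
  case (Suc j)
  show ?thesis
    by (rule that[of \<one> "merge G j as"]) (use Suc assms merge_closed[of as j] in simp_all)
qed

section \<open>Normalization of a cocycle at tuples beginning with \<open>\<one>\<close>\<close>

context natural_system
begin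

definition front :: "nat \<Rightarrow> ('a list \<Rightarrow> 'b) \<Rightarrow> 'a list \<Rightarrow> 'b" where
  "front n f = (\<lambda>as \<in> Ner S z n. T (hd as, mprod S (tl as), \<one>) (f (\<one> # \<one> # tl as)))"

lemma Ner_one_Cons_iff: "\<one> # as \<in> Ner S z (Suc n) \<longleftrightarrow> as \<in> Ner S z n"
  by (auto simp: Ner_def)

lemma mprod_one_Cons: "as \<in> Ner S z n \<Longrightarrow> mprod S (\<one> # as) = mprod S as"
  by (simp add: Ner_def)

lemma T_hom_left:
  assumes "a # as \<in> Ner S z (Suc n)"
  shows "T (a, mprod S as, \<one>) \<in> hom (D (mprod S as)) (D (mprod S (a # as)))"
proof -
  have "mprod S (a # as @ [\<one>]) = mprod S (a # as)"
    using assms by (auto simp: Ner_def mprod_append)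
  moreover from this have "a # as @ [\<one>] \<in> Ner S z (Suc (Suc n))"
    using assms by (simp add: Ner_def)
  moreover have "length as = n" using assms by (simp add: Ner_def)
  ultimately show ?thesis using T_hom_outer[of a as \<one> n] by simp
qed

lemma front_closed:
  assumes f: "f \<in> carrier (cochain_group S z D (Suc (Suc n)))"
  shows "front (Suc n) f \<in> carrier (cochain_group S z D (Suc n))"
proof -
  have "front (Suc n) f (a # as) \<in> carrier (D (mprod S (a # as)))"
    if as: "a # as \<in> Ner S z (Suc n)" for a as
  proof -
    note as' = Ner_ConsD(1)[OF as]
    have "f (\<one> # \<one> # as) \<in> carrier (D (mprod S as))"
      using cochain_closed[OF f, of "\<one> # \<one> # as"] as' mprod_one_Cons[of "\<one> # as" "Suc n"] mprod_one_Cons[OF as']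
      by (simp add: Ner_one_Cons_iff)
    then show ?thesis
      using hom_in_carrier[OF T_hom_left[OF as]] as by (simp add: front_def)
  qed
  then have "front (Suc n) f as \<in> carrier (D (mprod S as))" if "as \<in> Ner S z (Suc n)" for as
    using that by (cases as) (simp_all add: Ner_def)
  then show ?thesis
    by (auto simp: cochain_group_def front_def)
qed

text \<open>The first two faces cancel.\<close>

lemma coboundary_one_Cons:
  assumes g: "g \<in> carrier (cochain_group S z D (Suc n))" and as: "as \<in> Ner S z (Suc n)"
  shows "coboundary S z D T (Suc n) g (\<one> # as) =
    altprod (D (mprod S as)) (\<lambda>i. bar S T g (\<one> # \<one> # merge S i (as @ [\<one>]))) n"
proof -
  have as1: "\<one> # as \<in> Ner S z (Suc (Suc n))" using as by (simp add: Ner_one_Cons_iff)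
  interpret G: comm_group "D (mprod S as)" using as by (rule comm_group_Ner)
  define k where "k = (\<lambda>i. bar S T g (merge S i (\<one> # \<one> # as @ [\<one>])))"
  have k [simp]: "k i \<in> carrier (D (mprod S as))" if "i \<le> Suc (Suc n)" for i
    using bar_merge_closed[OF g Ner_extend[OF as1] that] mprod_extend[OF as1] mprod_one_Cons[OF as]
    by (simp add: k_def)
  have "coboundary S z D T (Suc n) g (\<one> # as) = altprod (D (mprod S as)) k (Suc (Suc n))"
    using coboundary_eq[OF g as1] mprod_one_Cons[OF as] by (simp add: k_def)
  also have "\<dots> = k 0 \<otimes>\<^bsub>D (mprod S as)\<^esub> inv\<^bsub>D (mprod S as)\<^esub>
      (k 1 \<otimes>\<^bsub>D (mprod S as)\<^esub> inv\<^bsub>D (mprod S as)\<^esub> altprod (D (mprod S as)) (\<lambda>i. k (Suc (Suc i))) n)"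
    by (simp add: G.altprod_Suc)
  \<comment> \<open>Merging the two leading \<open>\<one>\<close>, or the second of them with the
    head of \<open>as\<close>, gives the same tuple \<open>\<one> # as @ [\<one>]\<close>.\<close>
  also have "k 1 = k 0"
    using as by (cases as) (auto simp: k_def Ner_def)
  also have "k 0 \<otimes>\<^bsub>D (mprod S as)\<^esub> inv\<^bsub>D (mprod S as)\<^esub>
      (k 0 \<otimes>\<^bsub>D (mprod S as)\<^esub> inv\<^bsub>D (mprod S as)\<^esub> altprod (D (mprod S as)) (\<lambda>i. k (Suc (Suc i))) n) =
      altprod (D (mprod S as)) (\<lambda>i. k (Suc (Suc i))) n"
    by (simp add: G.inv_mult_group G.m_assoc[symmetric] G.m_comm[of _ "inv\<^bsub>D (mprod S as)\<^esub> k 0"])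
  finally show ?thesis by (simp add: k_def)
qed

text \<open>Once the first two faces cancel, the left side is an alternating product of transported
  values of \<open>f\<close> at tuples beginning with \<open>\<one>, \<one>\<close>. The cocycle
  condition at \<open>\<one> # \<one> # as\<close>, expanded in the same way, says that this product
  is \<open>f (\<one> # as)\<close>.\<close>

lemma coboundary_front:
  assumes f: "f \<in> cocycles S z D T (Suc (Suc n))" and as: "as \<in> Ner S z (Suc n)"
  shows "coboundary S z D T (Suc n) (front (Suc n) f) (\<one> # as) = f (\<one> # as)"
proof -
  have fC: "f \<in> carrier (cochain_group S z D (Suc (Suc n)))"
    and cocycle: "\<And>as. as \<in> Ner S z (Suc (Suc (Suc n))) \<Longrightarrow>
      coboundary S z D T (Suc (Suc n)) f as = \<one>\<^bsub>D (mprod S as)\<^esub>"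
    using f by (auto simp: cocycle_iff)
  have gC: "front (Suc n) f \<in> carrier (cochain_group S z D (Suc n))"
    using fC by (rule front_closed)
  have as1: "\<one> # as \<in> Ner S z (Suc (Suc n))" and as2: "\<one> # \<one> # as \<in> Ner S z (Suc (Suc (Suc n)))"
    using as by (simp_all add: Ner_one_Cons_iff)
  interpret G: comm_group "D (mprod S as)" using as by (rule comm_group_Ner)
  have mas1: "mprod S (\<one> # as) = mprod S as" using as by (rule mprod_one_Cons)
  have c: "f (\<one> # as) \<in> carrier (D (mprod S as))"
    using cochain_closed[OF fC as1] mas1 by simp
  have k: "bar S T f (\<one> # \<one> # \<one> # merge S i (as @ [\<one>])) \<in> carrier (D (mprod S as))" if "i \<le> n" for i
    using bar_merge_closed[OF fC Ner_extend[OF as2], of "Suc (Suc (Suc i))"] that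
      mprod_extend[OF as2] mprod_one_Cons[OF as1] mas1 by simp
  have "coboundary S z D T (Suc n) (front (Suc n) f) (\<one> # as) =
      altprod (D (mprod S as)) (\<lambda>i. bar S T f (\<one> # \<one> # \<one> # merge S i (as @ [\<one>]))) n"
    unfolding coboundary_one_Cons[OF gC as]
  proof (rule G.altprod_cong)
    fix i assume i: "i \<le> n"
    have "as @ [\<one>] \<in> Ner S z (Suc (Suc n))"
      using as by (auto simp: Ner_def mprod_append)
    then have m: "merge S i (as @ [\<one>]) \<in> Ner S z (Suc n)"
      using i by (simp add: Ner_merge)
    then have "merge S i (as @ [\<one>]) \<noteq> []" by (auto simp: Ner_def)
    then obtain bs v where bs: "merge S i (as @ [\<one>]) = bs @ [v]" by (metis rev_exhaust)
    have bsN: "bs \<in> Ner S z n" using m bs Ner_snocD by simp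
    have "f (\<one> # \<one> # bs) \<in> carrier (D (mprod S bs))"
      using cochain_closed[OF fC, of "\<one> # \<one> # bs"] bsN by (simp add: Ner_one_Cons_iff Ner_def)
    then have "T (\<one>, mprod S bs, \<one>) (f (\<one> # \<one> # bs)) = f (\<one> # \<one> # bs)"
      by (rule T_id[OF Ner_fac_obj[OF bsN]])
    then show "bar S T (front (Suc n) f) (\<one> # \<one> # merge S i (as @ [\<one>])) =
        bar S T f (\<one> # \<one> # \<one> # merge S i (as @ [\<one>]))"
      using bar_Cons_snoc[of S T "front (Suc n) f" \<one> "\<one> # bs" v] bar_Cons_snoc[of S T f \<one> "\<one> # \<one> # bs" v] bsN
      by (simp add: bs front_def Ner_one_Cons_iff mprod_one_Cons mprod_one_Cons[of "\<one> # _"] Ner_def)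
  qed (rule k)
  moreover have "f (\<one> # as) \<otimes>\<^bsub>D (mprod S as)\<^esub> inv\<^bsub>D (mprod S as)\<^esub>
      altprod (D (mprod S as)) (\<lambda>i. bar S T f (\<one> # \<one> # \<one> # merge S i (as @ [\<one>]))) n = \<one>\<^bsub>D (mprod S as)\<^esub>"
  proof -
    have "coboundary S z D T (Suc (Suc n)) f (\<one> # \<one> # as) =
        altprod (D (mprod S as)) (\<lambda>i. bar S T f (\<one> # \<one> # merge S i (\<one> # as @ [\<one>]))) (Suc n)"
      using coboundary_one_Cons[OF fC as1] mas1 by simp
    also have "\<dots> = bar S T f (\<one> # (\<one> # as) @ [\<one>]) \<otimes>\<^bsub>D (mprod S as)\<^esub> inv\<^bsub>D (mprod S as)\<^esub>
        altprod (D (mprod S as)) (\<lambda>i. bar S T f (\<one> # \<one> # \<one> # merge S i (as @ [\<one>]))) n"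
    proof (subst G.altprod_Suc)
      fix i assume "i \<le> Suc n"
      then show "bar S T f (\<one> # \<one> # merge S i (\<one> # as @ [\<one>])) \<in> carrier (D (mprod S as))"
        using bar_merge_closed[OF fC Ner_extend[OF as2], of "Suc (Suc i)"]
          mprod_extend[OF as2] mprod_one_Cons[OF as1] mas1 by simp
    qed (use as in \<open>cases as; simp add: Ner_def\<close>)
    finally show ?thesis
      using cocycle[OF as2] bar_extend[OF fC as1] mas1 mprod_one_Cons[OF as1] by simp
  qed
  ultimately show ?thesis
    using c k G.inv_solve_right[of "\<one>\<^bsub>D (mprod S as)\<^esub>" "f (\<one> # as)"
      "altprod (D (mprod S as)) (\<lambda>i. bar S T f (\<one> # \<one> # \<one> # merge S i (as @ [\<one>]))) n"] by simp
qed

end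

section \<open>The primitive of a normalized cocycle\<close>

locale split_natural_system = natural_system S z D T + letter_splitting S z len p q
  for S :: "('a, 'm) monoid_scheme" (structure) and z and D :: "'a \<Rightarrow> ('b, 'n) monoid_scheme" and T len p q
begin

text \<open>The number \<open>k\<close> of letters still to be split off drives the recursion, since
  \<open>q a\<close> is not structurally smaller than \<open>a\<close>. It starts at
  \<open>len a\<close>, so that the clause for 0 is reached exactly at
  \<open>a = \<one>\<close>.\<close>

primrec contract_aux :: "('a list \<Rightarrow> 'b) \<Rightarrow> nat \<Rightarrow> 'a \<Rightarrow> 'a list \<Rightarrow> 'b" where
  "contract_aux f 0 a as = \<one>\<^bsub>D (mprod S (a # as))\<^esub>"
| "contract_aux f (Suc k) a as = T (p a, mprod S (q a # as), \<one>) (contract_aux f k (q a) as)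
     \<otimes>\<^bsub>D (mprod S (a # as))\<^esub> inv\<^bsub>D (mprod S (a # as))\<^esub> f (p a # q a # as)"

text \<open>If \<open>a = x\<^sub>1 \<cdots> x\<^sub>k\<close> with letters \<open>x\<^sub>i\<close>, the value at \<open>(a, as)\<close> is, additively,
  \<open>- (\<Sum>i. (x\<^sub>1 \<cdots> x\<^sub>i\<^sub>-\<^sub>1)\<^sub>* f (x\<^sub>i, x\<^sub>i\<^sub>+\<^sub>1 \<cdots> x\<^sub>k, as))\<close>.\<close>

definition contract :: "nat \<Rightarrow> ('a list \<Rightarrow> 'b) \<Rightarrow> 'a list \<Rightarrow> 'b" where
  "contract n f = (\<lambda>as \<in> Ner S z n. contract_aux f (len (hd as)) (hd as) (tl as))"

lemma Ner_split:
  assumes "a # as \<in> Ner S z (Suc n)" "a \<noteq> \<one>"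
  shows "p a # q a # as \<in> Ner S z (Suc (Suc n))" "q a # as \<in> Ner S z (Suc n)"
    "mprod S (p a # q a # as) = mprod S (a # as)"
proof -
  note a = Ner_ConsD[OF assms(1)]
  have "p a \<in> carrier S" "q a \<in> carrier S" "p a \<otimes> q a = a"
    using p_closed q_closed p_mult_q a(2,3) assms(2) by blast+
  moreover from this show "mprod S (p a # q a # as) = mprod S (a # as)"
    using assms by (auto simp: Ner_def m_assoc[symmetric])
  ultimately show *: "p a # q a # as \<in> Ner S z (Suc (Suc n))"
    using assms by (auto simp: Ner_def)
  show "q a # as \<in> Ner S z (Suc n)"
    using Ner_ConsD(1)[OF *] .
qed

lemma contract_one:
  assumes "as \<in> Ner S z n"
  shows "contract (Suc n) f (\<one> # as) = \<one>\<^bsub>D (mprod S as)\<^esub>"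
proof -
  have "\<one> # as \<in> Ner S z (Suc n)" using assms by (simp add: Ner_one_Cons_iff)
  then show ?thesis
    using len_eq_0[of \<one>] Ner_ConsD(3)[of \<one> as n] mprod_one_Cons[OF assms] by (simp add: contract_def)
qed

lemma contract_Cons:
  assumes "a # as \<in> Ner S z (Suc n)" "a \<noteq> \<one>"
  shows "contract (Suc n) f (a # as) = T (p a, mprod S (q a # as), \<one>) (contract (Suc n) f (q a # as))
    \<otimes>\<^bsub>D (mprod S (a # as))\<^esub> inv\<^bsub>D (mprod S (a # as))\<^esub> f (p a # q a # as)"
  using assms Ner_split(2)[OF assms] len_q[of a] Ner_ConsD[OF assms(1)] by (simp add: contract_def)

lemma contract_closed:
  assumes f: "f \<in> carrier (cochain_group S z D (Suc (Suc n)))"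
  shows "contract (Suc n) f \<in> carrier (cochain_group S z D (Suc n))"
proof -
  have "contract (Suc n) f (a # as) \<in> carrier (D (mprod S (a # as)))" if "a # as \<in> Ner S z (Suc n)" for a as
    using that
  proof (induction "len a" arbitrary: a rule: less_induct)
    case less
    interpret G: comm_group "D (mprod S (a # as))" using less.prems by (rule comm_group_Ner)
    show ?case
    proof (cases "a = \<one>")
      case True
      then show ?thesis
        using contract_one[of as n f] less.prems mprod_one_Cons[of as n] G.one_closed by (simp add: Ner_one_Cons_iff)
    next
      case False
      note split = Ner_split[OF less.prems False]
      have "contract (Suc n) f (q a # as) \<in> carrier (D (mprod S (q a # as)))"
        using less.hyps[OF _ split(2)] len_q[of a] Ner_ConsD[OF less.prems] False by simp
      then have "T (p a, mprod S (q a # as), \<one>) (contract (Suc n) f (q a # as)) \<in> carrier (D (mprod S (a # as)))"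
        using hom_in_carrier[OF T_hom_left[OF split(1)]] split(3) by simp
      moreover have "f (p a # q a # as) \<in> carrier (D (mprod S (a # as)))"
        using cochain_closed[OF f split(1)] by (simp only: split(3))
      ultimately show ?thesis
        unfolding contract_Cons[OF less.prems False] by (intro G.m_closed G.inv_closed)
    qed
  qed
  then have "contract (Suc n) f as \<in> carrier (D (mprod S as))" if "as \<in> Ner S z (Suc n)" for as
    using that by (cases as) (simp_all add: Ner_def)
  then show ?thesis
    by (auto simp: cochain_group_def contract_def)
qed

end

context split_natural_system
begin

text \<open>The cocycle condition at \<open>(x, w, as)\<close>, with \<open>a = x w\<close> and \<open>x\<close> a letter, carries the
  claim from \<open>w\<close> to \<open>a\<close>.\<close>

lemma coboundary_contract_step:
  assumes f: "f \<in> cocycles S z D T (Suc (Suc n))"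
    and as: "a # as \<in> Ner S z (Suc (Suc n))" and a1: "a \<noteq> \<one>"
    and IH: "coboundary S z D T (Suc n) (contract (Suc n) f) (q a # as) = f (q a # as)"
  shows "coboundary S z D T (Suc n) (contract (Suc n) f) (a # as) = f (a # as)"
proof -
  define g where "g = contract (Suc n) f"
  define x w where "x = p a" and "w = q a"
  have fC: "f \<in> carrier (cochain_group S z D (Suc (Suc n)))"
    using f by (simp add: cocycle_iff)
  then have gC: "g \<in> carrier (cochain_group S z D (Suc n))"
    unfolding g_def by (rule contract_closed)
  note split = Ner_split[OF as a1, folded x_def w_def]
  have aS: "a \<in> carrier S" "x \<in> carrier S" "w \<in> carrier S" and asS: "set as \<subseteq> carrier S" "length as = Suc n"
    using Ner_ConsD[OF as] Ner_ConsD[OF split(1)] Ner_ConsD[OF split(2)] by (auto simp: Ner_def)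
  have xw: "x \<otimes> w = a"
    using p_mult_q[of a] Ner_ConsD[OF as] a1 by (simp add: x_def w_def)
  define G where "G = D (mprod S (a # as))"
  interpret G: comm_group G unfolding G_def using as by (rule comm_group_Ner)
  interpret W: comm_group "D (mprod S (w # as))" using split(2) by (rule comm_group_Ner)
  define X where "X = T (x, mprod S (w # as), \<one>)"
  have X: "X \<in> hom (D (mprod S (w # as))) G"
    unfolding X_def G_def using T_hom_left[OF split(1)] by (simp only: split(3))
  \<comment> \<open>The faces to be compared: \<open>A\<close> of \<open>g\<close> at
    \<open>a # as\<close>, \<open>B\<close> of \<open>g\<close> at \<open>w # as\<close>,
    \<open>C\<close> of \<open>f\<close> at \<open>x # w # as\<close>. The first two of
    \<open>C\<close> are \<open>X (f (w # as))\<close> and \<open>f (a # as)\<close>;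
    \<open>C'\<close> keeps the others, shifted by one to match \<open>A\<close> and
    \<open>B\<close>, with a neutral entry at 0.\<close>
  define A where "A = (\<lambda>i. bar S T g (merge S i (\<one> # (a # as) @ [\<one>])))"
  define B where "B = (\<lambda>i. bar S T g (merge S i (\<one> # (w # as) @ [\<one>])))"
  define C where "C = (\<lambda>i. bar S T f (merge S i (\<one> # (x # w # as) @ [\<one>])))"
  define C' where "C' = (\<lambda>i. if i = 0 then \<one>\<^bsub>G\<^esub> else C (Suc i))"
  have A: "A i \<in> carrier G" if "i \<le> Suc (Suc n)" for i
    using bar_merge_closed[OF gC Ner_extend[OF as] that] unfolding A_def G_def mprod_extend[OF as] .
  have B: "B i \<in> carrier (D (mprod S (w # as)))" if "i \<le> Suc (Suc n)" for i
    using bar_merge_closed[OF gC Ner_extend[OF split(2)] that] unfolding B_def mprod_extend[OF split(2)] .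
  have C: "C i \<in> carrier G" if "i \<le> Suc (Suc (Suc n))" for i
    using bar_merge_closed[OF fC Ner_extend[OF split(1)] that]
    unfolding C_def G_def mprod_extend[OF split(1)] split(3) .
  have C': "C' i \<in> carrier G" if "i \<le> Suc (Suc n)" for i
    using C that by (simp add: C'_def)
  \<comment> \<open>The recursion of \<open>contract\<close>, transported to a face. Face 0 removes
    the first entry from the argument of \<open>g\<close>, so functoriality and
    \<open>x w = a\<close> suffice; on any other face the first entries are \<open>w c\<close> and
    \<open>a c\<close>, and \<open>a c\<close> splits into \<open>x\<close> and
    \<open>w c\<close>.\<close>
  have face: "X (B i) = A i \<otimes>\<^bsub>G\<^esub> C' i" if i: "i \<le> Suc (Suc n)" for i
  proof (cases i)
    case 0
    have "x # w # as @ [\<one>, \<one>] \<in> Ner S z (Suc (Suc (Suc (Suc (Suc n)))))"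
      using split(1) by (auto simp: Ner_def mprod_append)
    from T_T[OF this cochain_closed[OF gC Ner_ConsD(1)[OF split(2)]]]
    have "X (B 0) = A 0"
      using aS asS bar_Cons_snoc[of S T g w as \<one>] bar_Cons_snoc[of S T g a as \<one>]
      by (simp add: X_def A_def B_def mprod_append xw)
    then show ?thesis using A[of 0] 0 by (simp add: C'_def)
  next
    case (Suc j)
    have "set (as @ [\<one>]) \<subseteq> carrier S" "as @ [\<one>] \<noteq> []" using asS by auto
    then obtain c ys where c: "c \<in> carrier S" and ys: "set ys \<subseteq> carrier S"
      and m: "\<And>e. e \<in> carrier S \<Longrightarrow> merge S j (e # as @ [\<one>]) = (e \<otimes> c) # ys"
      using merge_Cons_cases by metis
    have "length (merge S j (w # as @ [\<one>])) = Suc (Suc n)"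
      using asS i Suc by (simp add: length_merge)
    then have "length ys = Suc n" using m[OF aS(3)] by simp
    then obtain bs v where bs: "ys = bs @ [v]" by (cases ys rule: rev_cases) auto
    have v: "v \<in> carrier S" and bsS: "set bs \<subseteq> carrier S" and bsl: "length bs = n"
      using ys bs \<open>length ys = Suc n\<close> by auto
    have wc: "(w \<otimes> c) # bs @ [v] \<in> Ner S z (Suc (Suc n))"
      "mprod S ((w \<otimes> c) # bs @ [v]) = mprod S (w # as)"
      "x # (w \<otimes> c) # bs @ [v] \<in> Ner S z (Suc (Suc (Suc n)))"
    proof -
      have "mprod S (merge S j (w # as @ [\<one>])) = mprod S (w # as @ [\<one>])"
        using asS aS by (intro mprod_merge) auto
      then show *: "mprod S ((w \<otimes> c) # bs @ [v]) = mprod S (w # as)"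
        using m[OF aS(3)] bs asS by (simp add: mprod_append)
      show "(w \<otimes> c) # bs @ [v] \<in> Ner S z (Suc (Suc n))"
        using split(2) * aS c v bsS bsl unfolding Ner_def by simp
      show "x # (w \<otimes> c) # bs @ [v] \<in> Ner S z (Suc (Suc (Suc n)))"
        using split(1) * aS c v bsS bsl unfolding Ner_def by simp
    qed
    have ac: "(a \<otimes> c) # bs \<in> Ner S z (Suc n)" "mprod S (x # (w \<otimes> c) # bs) = mprod S ((a \<otimes> c) # bs)"
      "a \<otimes> c \<noteq> \<one>" "p (a \<otimes> c) = x" "q (a \<otimes> c) = w \<otimes> c"
    proof -
      show *: "mprod S (x # (w \<otimes> c) # bs) = mprod S ((a \<otimes> c) # bs)"
        using aS c bsS xw by (simp add: m_assoc[symmetric])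
      have "x # (w \<otimes> c) # bs \<in> Ner S z (Suc (Suc n))"
        using Ner_snocD(1)[of "x # (w \<otimes> c) # bs" v] wc(3) by simp
      then show **: "(a \<otimes> c) # bs \<in> Ner S z (Suc n)"
        using * aS c bsS bsl unfolding Ner_def by simp
      have "a \<otimes> c \<noteq> z" using Ner_ConsD(3)[OF **] .
      then show "a \<otimes> c \<noteq> \<one>" "p (a \<otimes> c) = x" "q (a \<otimes> c) = w \<otimes> c"
        using mult_ne_one p_mult q_mult aS c a1 by (auto simp: x_def w_def)
    qed
    define H where "H = D (mprod S ((a \<otimes> c) # bs))"
    interpret H: comm_group H unfolding H_def using ac(1) by (rule comm_group_Ner)
    let ?V = "T (\<one>, mprod S ((a \<otimes> c) # bs), v)"
    let ?gw = "g ((w \<otimes> c) # bs)"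
    have wN: "(w \<otimes> c) # bs \<in> Ner S z (Suc n)"
      using Ner_snocD(1)[of "(w \<otimes> c) # bs" v] wc(1) by simp
    have xN: "x # (w \<otimes> c) # bs \<in> Ner S z (Suc (Suc n))"
      using Ner_snocD(1)[of "x # (w \<otimes> c) # bs" v] wc(3) by simp
    have gw: "?gw \<in> carrier (D (mprod S ((w \<otimes> c) # bs)))"
      using cochain_closed[OF gC wN] .
    have ga: "g ((a \<otimes> c) # bs) \<in> carrier H"
      using cochain_closed[OF gC ac(1)] unfolding H_def .
    have fx: "f (x # (w \<otimes> c) # bs) \<in> carrier H"
      using cochain_closed[OF fC xN] unfolding H_def ac(2) .
    have xg: "T (x, mprod S ((w \<otimes> c) # bs), \<one>) ?gw \<in> carrier H"
      using hom_in_carrier[OF T_hom_left[OF xN] gw] unfolding H_def ac(2) .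
    have "g ((a \<otimes> c) # bs) = T (x, mprod S ((w \<otimes> c) # bs), \<one>) ?gw \<otimes>\<^bsub>H\<^esub> inv\<^bsub>H\<^esub> f (x # (w \<otimes> c) # bs)"
      using contract_Cons[OF ac(1,3)] unfolding ac(4,5) g_def H_def .
    then have g_f: "g ((a \<otimes> c) # bs) \<otimes>\<^bsub>H\<^esub> f (x # (w \<otimes> c) # bs) = T (x, mprod S ((w \<otimes> c) # bs), \<one>) ?gw"
      using xg fx by (simp add: H.m_assoc)
    have V: "?V \<in> hom H G"
    proof -
      have "mprod S (\<one> # ((a \<otimes> c) # bs) @ [v]) = mprod S (x # (w \<otimes> c) # bs @ [v])"
        using aS c v bsS by (simp add: xw[symmetric] mprod_append m_assoc)
      also have "\<dots> = mprod S (x # w # as)"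
        by (simp only: mprod_Cons[of x] wc(2))
      also note split(3)
      finally have *: "mprod S (\<one> # ((a \<otimes> c) # bs) @ [v]) = mprod S (a # as)" .
      then have "\<one> # ((a \<otimes> c) # bs) @ [v] \<in> Ner S z (Suc (Suc (Suc n)))"
        using as aS c v bsS bsl unfolding Ner_def by simp
      from T_hom_outer[OF this] show ?thesis unfolding G_def H_def * .
    qed
    \<comment> \<open>The left action of \<open>x\<close> and the right action of \<open>v\<close>
      commute, as both composites are \<open>T (x, _, v)\<close>. This brings \<open>x\<close> next
      to \<open>g\<close>, where the recursion \<open>g_f\<close> applies.\<close>
    have "X (B i) = X (T (\<one>, mprod S ((w \<otimes> c) # bs), v) ?gw)"
      using m[OF aS(3)] bs bar_Cons_snoc[of S T g \<one> "(w \<otimes> c) # bs" v] by (simp add: B_def Suc)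
    also have "\<dots> = T (x, mprod S ((w \<otimes> c) # bs), v) ?gw"
    proof -
      have eq: "mprod S (\<one> # ((w \<otimes> c) # bs) @ [v]) = mprod S (w # as)"
        using mprod_one_Cons[OF wc(1)] wc(2) by simp
      have "x # \<one> # ((w \<otimes> c) # bs) @ [v, \<one>] \<in> Ner S z (Suc (Suc (Suc (Suc (Suc n)))))"
        using wc(3) by (auto simp: Ner_def mprod_append)
      from T_T[OF this gw] show ?thesis unfolding eq X_def using aS v by simp
    qed
    also have "\<dots> = ?V (T (x, mprod S ((w \<otimes> c) # bs), \<one>) ?gw)"
    proof -
      have eq: "mprod S (x # ((w \<otimes> c) # bs) @ [\<one>]) = mprod S ((a \<otimes> c) # bs)"
        using ac(2) aS c bsS by (simp add: mprod_append)
      have "\<one> # x # ((w \<otimes> c) # bs) @ [\<one>, v] \<in> Ner S z (Suc (Suc (Suc (Suc (Suc n)))))"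
        using wc(3) by (auto simp: Ner_def mprod_append)
      from T_T[OF this gw] show ?thesis unfolding eq using aS v by simp
    qed
    also have "\<dots> = ?V (g ((a \<otimes> c) # bs)) \<otimes>\<^bsub>G\<^esub> ?V (f (x # (w \<otimes> c) # bs))"
      unfolding g_f[symmetric] using hom_mult[OF V ga fx] .
    also have "?V (g ((a \<otimes> c) # bs)) = A i"
      using m[OF aS(1)] bs bar_Cons_snoc[of S T g \<one> "(a \<otimes> c) # bs" v] by (simp add: A_def Suc)
    also have "?V (f (x # (w \<otimes> c) # bs)) = C' i"
      using m[OF aS(3)] bs bar_Cons_snoc[of S T f \<one> "x # (w \<otimes> c) # bs" v] ac(2) by (simp add: C'_def C_def Suc)
    finally show ?thesis .
  qed
  have C0: "C 0 = X (f (w # as))"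
    using bar_Cons_snoc[of S T f x "w # as" \<one>] aS by (simp add: C_def X_def)
  have C1: "C 1 = f (a # as)"
    using bar_extend[OF fC as] aS by (simp add: C_def xw)
  have "C 0 \<otimes>\<^bsub>G\<^esub> inv\<^bsub>G\<^esub> altprod G (\<lambda>i. C (Suc i)) (Suc (Suc n)) = coboundary S z D T (Suc (Suc n)) f (x # w # as)"
    using coboundary_eq[OF fC split(1)] C unfolding split(3) G_def[symmetric] C_def[symmetric]
    by (simp add: G.altprod_Suc)
  also have "\<dots> = \<one>\<^bsub>G\<^esub>"
    using f split(1) unfolding cocycle_iff G_def split(3)[symmetric] by blast
  finally have "C 0 = altprod G (\<lambda>i. C (Suc i)) (Suc (Suc n))"
    using C G.inv_solve_right[of "\<one>\<^bsub>G\<^esub>" "C 0" "altprod G (\<lambda>i. C (Suc i)) (Suc (Suc n))"] by simp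
  \<comment> \<open>Since \<open>C' 0\<close> is neutral, \<open>altprod_Suc\<close> produces the
    same inverse tail from both alternating products.\<close>
  also have "\<dots> = C 1 \<otimes>\<^bsub>G\<^esub> altprod G C' (Suc (Suc n))"
    using C by (simp add: G.altprod_Suc C'_def)
  finally have C01: "C 0 = C 1 \<otimes>\<^bsub>G\<^esub> altprod G C' (Suc (Suc n))" .
  \<comment> \<open>The induction hypothesis at \<open>w\<close> expresses \<open>C 0\<close>
    through \<open>B\<close>, and \<open>face\<close> turns that into \<open>A\<close> and
    \<open>C'\<close>. Cancelling the common factor of \<open>C'\<close> then leaves the coboundary
    of \<open>g\<close> at \<open>a # as\<close> equal to \<open>C 1\<close>.\<close>
  have "altprod G (\<lambda>i. A i \<otimes>\<^bsub>G\<^esub> C' i) (Suc (Suc n)) = C 1 \<otimes>\<^bsub>G\<^esub> altprod G C' (Suc (Suc n))"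
  proof -
    have "C 0 = X (altprod (D (mprod S (w # as))) B (Suc (Suc n)))"
      using IH coboundary_eq[OF gC split(2)] unfolding C0 B_def g_def w_def by simp
    also have "\<dots> = altprod G (\<lambda>i. X (B i)) (Suc (Suc n))"
      using B by (intro W.altprod_hom[OF G.comm_group_axioms X])
    also have "\<dots> = altprod G (\<lambda>i. A i \<otimes>\<^bsub>G\<^esub> C' i) (Suc (Suc n))"
      using face A C' by (intro G.altprod_cong) simp_all
    finally show ?thesis
      using C01 by simp
  qed
  then have "altprod G A (Suc (Suc n)) \<otimes>\<^bsub>G\<^esub> altprod G C' (Suc (Suc n)) = C 1 \<otimes>\<^bsub>G\<^esub> altprod G C' (Suc (Suc n))"
    using A C' by (simp add: G.altprod_mult)
  then have "altprod G A (Suc (Suc n)) = C 1"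
    using A C C' by (subst (asm) G.right_cancel) simp_all
  then show ?thesis
    using coboundary_eq[OF gC as] C1 unfolding A_def G_def g_def by simp
qed

lemma coboundary_contract:
  assumes f: "f \<in> cocycles S z D T (Suc (Suc n))"
    and one: "\<And>as. as \<in> Ner S z (Suc n) \<Longrightarrow> f (\<one> # as) = \<one>\<^bsub>D (mprod S as)\<^esub>"
  shows "coboundary S z D T (Suc n) (contract (Suc n) f) = f"
proof -
  define g where "g = contract (Suc n) f"
  have fC: "f \<in> carrier (cochain_group S z D (Suc (Suc n)))"
    using f by (simp add: cocycle_iff)
  then have gC: "g \<in> carrier (cochain_group S z D (Suc n))"
    unfolding g_def by (rule contract_closed)
  have main: "coboundary S z D T (Suc n) g (a # as) = f (a # as)"
    if "a # as \<in> Ner S z (Suc (Suc n))" for a as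
    using that
  proof (induction "len a" arbitrary: a rule: less_induct)
    case less
    show ?case
    proof (cases "a = \<one>")
      case True
      then have as: "as \<in> Ner S z (Suc n)" using less.prems by (simp add: Ner_one_Cons_iff)
      interpret G: comm_group "D (mprod S as)" using as by (rule comm_group_Ner)
      \<comment> \<open>The surviving faces are images of values \<open>g (\<one> # bs)\<close>,
        which are neutral; the assumption \<open>one\<close> makes \<open>f\<close> neutral here as
        well.\<close>
      have "coboundary S z D T (Suc n) g (\<one> # as) = altprod (D (mprod S as)) (\<lambda>i. \<one>\<^bsub>D (mprod S as)\<^esub>) n"
        unfolding coboundary_one_Cons[OF gC as]
      proof (rule G.altprod_cong)
        fix i assume i: "i \<le> n"
        have as1: "as @ [\<one>] \<in> Ner S z (Suc (Suc n))" and mas1: "mprod S (as @ [\<one>]) = mprod S as"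
          using as by (auto simp: Ner_def mprod_append)
        have m: "merge S i (as @ [\<one>]) \<in> Ner S z (Suc n)"
          using as1 i by (simp add: Ner_merge)
        have mm: "mprod S (merge S i (as @ [\<one>])) = mprod S as"
          using as1 mas1 by (simp add: mprod_merge Ner_def)
        have "merge S i (as @ [\<one>]) \<noteq> []" using m by (auto simp: Ner_def)
        then obtain bs v where bs: "merge S i (as @ [\<one>]) = bs @ [v]" by (metis rev_exhaust)
        have bsN: "bs \<in> Ner S z n" using m bs Ner_snocD by simp
        have *: "\<one> # bs @ [v] \<in> Ner S z (Suc (Suc n))" "mprod S (\<one> # bs @ [v]) = mprod S as"
          using m mm bs mprod_one_Cons[OF m] by (simp_all add: Ner_one_Cons_iff)
        interpret H: comm_group "D (mprod S bs)" using bsN by (rule comm_group_Ner)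
        have "T (\<one>, mprod S bs, v) \<in> hom (D (mprod S bs)) (D (mprod S as))"
          using T_hom_outer[OF *(1)] *(2) by simp
        from hom_one[OF this H.is_group G.is_group]
        show "bar S T g (\<one> # \<one> # merge S i (as @ [\<one>])) = \<one>\<^bsub>D (mprod S as)\<^esub>"
          using bar_Cons_snoc[of S T g \<one> "\<one> # bs" v] contract_one[OF bsN] mprod_one_Cons[OF bsN]
          by (simp add: bs g_def)
      qed simp
      then show ?thesis using True one[OF as] by simp
    next
      case False
      show ?thesis
        unfolding g_def
        using less.hyps[OF _ Ner_split(2)[OF less.prems False]] len_q[of a] Ner_ConsD[OF less.prems] False
        by (intro coboundary_contract_step[OF f less.prems False]) (simp add: g_def)
    qed
  qed
  have "coboundary S z D T (Suc n) g as = f as" for as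
  proof (cases "as \<in> Ner S z (Suc (Suc n))")
    case True
    then show ?thesis using main by (cases as) (auto simp: Ner_def)
  next
    case False
    then show ?thesis
      using fC coboundary_closed[OF gC] by (auto simp: cochain_group_def PiE_iff extensional_def)
  qed
  then show ?thesis by (auto simp: g_def)
qed

lemma cocycles_subset_coboundaries:
  "cocycles S z D T (Suc (Suc n)) \<subseteq> coboundaries S z D T (Suc (Suc n))"
proof
  fix f assume f: "f \<in> cocycles S z D T (Suc (Suc n))"
  let ?C = "cochain_group S z D"
  interpret d: group_hom "?C (Suc n)" "?C (Suc (Suc n))" "coboundary S z D T (Suc n)"
    by (rule coboundary_group_hom)
  interpret d': group_hom "?C (Suc (Suc n))" "?C (Suc (Suc (Suc n)))" "coboundary S z D T (Suc (Suc n))"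
    by (rule coboundary_group_hom)
  have fC: "f \<in> carrier (?C (Suc (Suc n)))" and df: "coboundary S z D T (Suc (Suc n)) f = \<one>\<^bsub>?C (Suc (Suc (Suc n)))\<^esub>"
    using f by (auto simp: cocycles_def kernel_def)
  define h where "h = front (Suc n) f"
  have h: "h \<in> carrier (?C (Suc n))" unfolding h_def using fC by (rule front_closed)
  define e where "e = coboundary S z D T (Suc n) h"
  have e: "e \<in> carrier (?C (Suc (Suc n)))" using h by (simp add: e_def)
  define f' where "f' = f \<otimes>\<^bsub>?C (Suc (Suc n))\<^esub> inv\<^bsub>?C (Suc (Suc n))\<^esub> e"
  have f'C: "f' \<in> carrier (?C (Suc (Suc n)))" using fC e by (simp add: f'_def)
  have "coboundary S z D T (Suc (Suc n)) e = \<one>\<^bsub>?C (Suc (Suc (Suc n)))\<^esub>"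
    unfolding e_def by (rule coboundary_coboundary[OF h])
  then have f': "f' \<in> cocycles S z D T (Suc (Suc n))"
    using f'C fC e df by (simp add: cocycles_def kernel_def f'_def)
  have "f' (\<one> # as) = \<one>\<^bsub>D (mprod S as)\<^esub>" if as: "as \<in> Ner S z (Suc n)" for as
  proof -
    interpret G: comm_group "D (mprod S as)" using as by (rule comm_group_Ner)
    have as1: "\<one> # as \<in> Ner S z (Suc (Suc n))" using as by (simp add: Ner_one_Cons_iff)
    have mas1: "mprod S (\<one> # as) = mprod S as" using as by (rule mprod_one_Cons)
    have "f = f' \<otimes>\<^bsub>?C (Suc (Suc n))\<^esub> e"
      using fC e by (simp add: f'_def d.H.m_assoc)
    then have "f (\<one> # as) = (f' \<otimes>\<^bsub>?C (Suc (Suc n))\<^esub> e) (\<one> # as)"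
      by (rule arg_cong)
    also have "\<dots> = f' (\<one> # as) \<otimes>\<^bsub>D (mprod S as)\<^esub> e (\<one> # as)"
      using as1 mas1 by (simp add: cochain_group_def)
    also have "e (\<one> # as) = f (\<one> # as)"
      unfolding e_def h_def by (rule coboundary_front[OF f as])
    finally show ?thesis
      using cochain_closed[OF fC as1] cochain_closed[OF f'C as1] unfolding mas1
      by (metis G.r_cancel_one')
  qed
  from coboundary_contract[OF f' this]
  have "coboundary S z D T (Suc n) (contract (Suc n) f') = f'" .
  \<comment> \<open>The correction \<open>e\<close>, the coboundary of \<open>h\<close>, is put
    back, so a primitive of \<open>f\<close> is the product of that of \<open>f'\<close> with
    \<open>h\<close>.\<close>
  then have "f = coboundary S z D T (Suc n) (contract (Suc n) f') \<otimes>\<^bsub>?C (Suc (Suc n))\<^esub> coboundary S z D T (Suc n) h"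
    using fC e by (simp add: f'_def e_def[symmetric] d.H.m_assoc)
  also have "\<dots> = coboundary S z D T (Suc n) (contract (Suc n) f' \<otimes>\<^bsub>?C (Suc n)\<^esub> h)"
    using contract_closed[OF f'C] h by simp
  finally show "f \<in> coboundaries S z D T (Suc (Suc n))"
    using d.G.m_closed[OF contract_closed[OF f'C] h] by (auto simp: coboundaries_def)
qed

end

theorem theorem10:
  fixes M :: "('a, 'm) monoid_scheme" and z :: 'a and X :: "'x set"
  assumes "monoid_with_zero M z" and "\<one>\<^bsub>M\<^esub> \<noteq> z" and "zero_free_on X M"
  shows "cohomological_dimension TYPE('b) M z \<le> 1"
proof -
  obtain len p q where split: "letter_splitting M z len p q"
    using letter_splitting_of_zero_free[OF assms] by blast
  have "trivial_group (cohomology_group M z D T n)"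
    if "1 < n" and D: "natural_system M z D T" for n and D :: "'a \<Rightarrow> 'b monoid" and T
  proof -
    interpret split_natural_system M z D T len p q
      using D split by (simp add: split_natural_system_def)
    have "n = Suc (Suc (n - 2))" using \<open>1 < n\<close> by simp
    then show ?thesis
      using trivial_cohomology_groupI[OF cocycles_subset_coboundaries[of "n - 2"]] by simp
  qed
  then show ?thesis
    unfolding one_enat_def cohomological_dimension_le_iff by blast
qed

end
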